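(* Let $n\ge1$, let $\tilde c^n_{i,j}$ be the conductance between $x_i$ and $x_j$ for the set $\{x_0,\dots,x_{2^n}\}$ (the bottom row of $V_n$), and set $\tilde b_n=\tilde c^n_{0,2^n}$. Then $\tilde c^n_{0,j}=2\tilde b_n$ for $2^{n-1}<j<2^n$; $\tilde c^n_{j,2^n}=2\tilde b_n$ for $0<j<2^{n-1}$; and $\tilde c^n_{i,j}=4\tilde b_n$ for $0<i<2^{n-1}$, $2^{n-1}<j<2^n$. Also $$\tilde b_n=\frac{a_n}{2^{n+1}}+b_n,$$ where $a_n$ and $b_n$ are the conductances between $q_0$ and $x_0$, respectively between $x_0$ and $x_{2^n}$, for the set $\{x_0,\dots,x_{2^n}\}\cup\{q_0\}$. More specifically, $$\tilde b_n=\frac{35\cdot5^n}{10\cdot6^n+32\cdot20^n}.$$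
   Context: Let $q_0,q_1,q_2$ be the vertices of an equilateral triangle in the plane, $F_i(x)=\frac12(x+q_i)$, and let $SG$ (the Sierpinski gasket) be the unique nonempty compact set with $SG=\bigcup_{i}F_i(SG)$. For a word $w$ of length $m$ let $F_w=F_{w_1}\circ\cdots\circ F_{w_m}$. Put $V_0=\{q_0,q_1,q_2\}$, $V_m=\bigcup_iF_iV_{m-1}$; $x\sim_m y$ means $x\ne y$ and $x,y\in F_wV_0$ for some word $w$ of length $m$. The bottom row of $V_n$ consists of the points $x_i=q_1+\frac{i}{2^n}(q_2-q_1)$, $0\le i\le2^n$. The energy of a continuous $u:SG\to\mathbb{R}$ is $\mathcal{E}(u)=\lim_{m\to\infty}\left(\frac53\right)^m\sum_{\{x,y\}:x\sim_m y}(u(x)-u(y))^2$ (a nondecreasing limit), and $\operatorname{dom}\mathcal{E}$ is the set of continuous $u$ with $\mathcal{E}(u)<\infty$. For a nonempty set $A\subset V_n$ and values prescribed on $A$, there is a unique $u\in\operatorname{dom}\mathcal{E}$ of least energy with these values on $A$, and its energy has the form $\mathcal{E}(u)=\sum_{\{x,y\}\subset A}c_{x,y}(u(x)-u(y))^2$; the (uniquely determined, symmetric) coefficients $c_{x,y}$, $x\neq y$, are the conductances for the set $A$. *)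

theory Defs
  imports "HOL-Analysis.Analysis"
begin

text \<open>Only \<open>q 0\<close>, \<open>q 1\<close>, \<open>q 2\<close> matter: they are the three vertices, and words are lists over
  \<open>{..<3}\<close>.\<close>

definition equilateral :: "(nat \<Rightarrow> real^2) \<Rightarrow> bool" where
  "equilateral q \<longleftrightarrow> q 0 \<noteq> q 1 \<and> dist (q 0) (q 1) = dist (q 1) (q 2)
     \<and> dist (q 1) (q 2) = dist (q 2) (q 0)"

definition F :: "(nat \<Rightarrow> real^2) \<Rightarrow> nat \<Rightarrow> real^2 \<Rightarrow> real^2" where
  "F q i x = (1/2) *\<^sub>R (x + q i)"

definition SG :: "(nat \<Rightarrow> real^2) \<Rightarrow> (real^2) set" where
  "SG q = (THE K. compact K \<and> K \<noteq> {} \<and> K = (\<Union>i<3. F q i ` K))"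

definition words :: "nat \<Rightarrow> nat list set" where
  "words m = {w. length w = m \<and> set w \<subseteq> {..<3}}"

definition Fw :: "(nat \<Rightarrow> real^2) \<Rightarrow> nat list \<Rightarrow> real^2 \<Rightarrow> real^2" where
  "Fw q w = foldr (F q) w"

primrec V :: "(nat \<Rightarrow> real^2) \<Rightarrow> nat \<Rightarrow> (real^2) set" where
  "V q 0 = q ` {..<3}"
| "V q (Suc m) = (\<Union>i<3. F q i ` V q m)"

definition adj :: "(nat \<Rightarrow> real^2) \<Rightarrow> nat \<Rightarrow> real^2 \<Rightarrow> real^2 \<Rightarrow> bool" where
  "adj q m x y \<longleftrightarrow> x \<noteq> y \<and> (\<exists>w\<in>words m. x \<in> Fw q w ` V q 0 \<and> y \<in> Fw q w ` V q 0)"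

text \<open>The sums over unordered pairs \<open>{x, y}\<close> are written, here and in \<open>conductance_form\<close>, as half
  the sums over ordered pairs.\<close>

definition graph_energy :: "(nat \<Rightarrow> real^2) \<Rightarrow> nat \<Rightarrow> (real^2 \<Rightarrow> real) \<Rightarrow> real" where
  "graph_energy q m u =
     (5/3)^m * ((1/2) * (\<Sum>(x,y)\<in>{(x,y). adj q m x y}. (u x - u y)^2))"

text \<open>Functions on the gasket are functions on the plane of which only the values on \<open>SG q\<close>
  are relevant.\<close>

definition energy :: "(nat \<Rightarrow> real^2) \<Rightarrow> (real^2 \<Rightarrow> real) \<Rightarrow> ereal" where
  "energy q u = lim (\<lambda>m. ereal (graph_energy q m u))"

definition dom_energy :: "(nat \<Rightarrow> real^2) \<Rightarrow> (real^2 \<Rightarrow> real) set" where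
  "dom_energy q = {u. continuous_on (SG q) u \<and> energy q u < \<infinity>}"

definition least_energy_extension ::
  "(nat \<Rightarrow> real^2) \<Rightarrow> (real^2) set \<Rightarrow> (real^2 \<Rightarrow> real) \<Rightarrow> (real^2 \<Rightarrow> real) \<Rightarrow> bool" where
  "least_energy_extension q A f u \<longleftrightarrow>
     u \<in> dom_energy q \<and> (\<forall>x\<in>A. u x = f x) \<and>
     (\<forall>v\<in>dom_energy q. (\<forall>x\<in>A. v x = f x) \<longrightarrow> energy q u \<le> energy q v)"

definition conductance_form ::
  "(real^2) set \<Rightarrow> (real^2 \<Rightarrow> real^2 \<Rightarrow> real) \<Rightarrow> (real^2 \<Rightarrow> real) \<Rightarrow> real" where
  "conductance_form A c u = (1/2) * (\<Sum>x\<in>A. \<Sum>y\<in>A. c x y * (u x - u y)^2)"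

text \<open>Conductances are only meaningful for distinct points of \<open>A\<close>; setting them to zero elsewhere
  makes the function \<open>c\<close> unique.\<close>

definition conductances_for ::
  "(nat \<Rightarrow> real^2) \<Rightarrow> (real^2) set \<Rightarrow> (real^2 \<Rightarrow> real^2 \<Rightarrow> real) \<Rightarrow> bool" where
  "conductances_for q A c \<longleftrightarrow>
     (\<forall>x y. c x y = c y x) \<and>
     (\<forall>x y. x \<notin> A \<or> y \<notin> A \<or> x = y \<longrightarrow> c x y = 0) \<and>
     (\<forall>f. \<exists>u. least_energy_extension q A f u \<and> energy q u = ereal (conductance_form A c u))"

definition conductance ::
  "(nat \<Rightarrow> real^2) \<Rightarrow> (real^2) set \<Rightarrow> real^2 \<Rightarrow> real^2 \<Rightarrow> real" where
  "conductance q A = (THE c. conductances_for q A c)"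

definition row_pt :: "(nat \<Rightarrow> real^2) \<Rightarrow> nat \<Rightarrow> nat \<Rightarrow> real^2" where
  "row_pt q n i = q 1 + (real i / 2^n) *\<^sub>R (q 2 - q 1)"

definition bottom_row :: "(nat \<Rightarrow> real^2) \<Rightarrow> nat \<Rightarrow> (real^2) set" where
  "bottom_row q n = row_pt q n ` {0..2^n}"

definition c_tilde :: "(nat \<Rightarrow> real^2) \<Rightarrow> nat \<Rightarrow> nat \<Rightarrow> nat \<Rightarrow> real" where
  "c_tilde q n i j = conductance q (bottom_row q n) (row_pt q n i) (row_pt q n j)"

definition b_tilde :: "(nat \<Rightarrow> real^2) \<Rightarrow> nat \<Rightarrow> real" where
  "b_tilde q n = c_tilde q n 0 (2^n)"

definition a_cond :: "(nat \<Rightarrow> real^2) \<Rightarrow> nat \<Rightarrow> real" where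
  "a_cond q n = conductance q (bottom_row q n \<union> {q 0}) (q 0) (row_pt q n 0)"

definition b_cond :: "(nat \<Rightarrow> real^2) \<Rightarrow> nat \<Rightarrow> real" where
  "b_cond q n = conductance q (bottom_row q n \<union> {q 0}) (row_pt q n 0) (row_pt q n (2^n))"

end

theory Submission
  imports Defs
begin

text \<open>Write \<open>m\<close> for the mean of the values on the bottom row with the trapezoidal weights. If the value
  \<open>t\<close> at \<open>q\<^sub>0\<close> is prescribed as well, the least energy is \<open>E + S\<^sub>n (t - m)\<^sup>2\<close>, where \<open>E\<close> is the
  least energy for the row alone. This is proved by induction on \<open>n\<close>: the top cell is a triangle
  with conductances \<open>5/3\<close>, and eliminating the values at its two lower corners, which are the tops of
  the lower cells, gives \<open>S\<^sub>n\<^sub>+\<^sub>1 = (10/3) S\<^sub>n / (1 + S\<^sub>n)\<close> and shows that the least energy for the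
  row is \<open>5/3\<close> times the sum of those of the two halves plus
  \<open>(5/2) S\<^sub>n / (3 + S\<^sub>n) (m\<^sub>L - m\<^sub>R)\<^sup>2\<close>. Only this last square couples a point of the left half with a
  point of the right half, so the conductance between them is its coefficient times the
  product of their weights. The recursion for \<open>S\<^sub>n\<close> is affine in \<open>1 / S\<^sub>n\<close>.

  The lower bound on the energy follows from self-similarity of the graph energies alone; minimizers
  are glued from harmonic functions on cells, which are uniform limits of an iterated gluing that starts
  from affine functions.\<close>

subsection \<open>Conductances\<close>

lemma sum_lessThan_3: "(\<Sum>i<3. f i) = f 0 + f 1 + f (2::nat)" for f :: "nat \<Rightarrow> 'a::comm_monoid_add"
  by (simp add: eval_nat_numeral lessThan_Suc ac_simps)

lemma less_3_cases: "i < (3::nat) \<longleftrightarrow> i = 0 \<or> i = 1 \<or> i = 2"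
  by auto

text \<open>When \<open>(f i - f j)^2\<close> is expanded, the pure squares pick up the factor
  \<open>sum m I = 0\<close>, so only the mixed terms remain. The square of a linear functional that
  kills constants is thereby a conductance form with coefficients
  \<open>- (m i * m j)\<close>.\<close>

lemma square_zero_sum:
  fixes m f :: "'i \<Rightarrow> real"
  assumes "sum m I = 0"
  shows "(\<Sum>i\<in>I. m i * f i)^2 = (1/2) * (\<Sum>i\<in>I. \<Sum>j\<in>I. - (m i * m j) * (f i - f j)^2)"
proof -
  have "(\<Sum>i\<in>I. \<Sum>j\<in>I. - (m i * m j) * (f i - f j)^2)
      = (\<Sum>i\<in>I. \<Sum>j\<in>I. 2 * ((m i * f i) * (m j * f j)) - (m i * (f i)^2) * m j - m i * (m j * (f j)^2))"
    by (intro sum.cong refl) (simp add: power2_eq_square algebra_simps)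
  also have "\<dots> = 2 * ((\<Sum>i\<in>I. m i * f i) * (\<Sum>i\<in>I. m i * f i))
      - (\<Sum>i\<in>I. m i * (f i)^2) * sum m I - sum m I * (\<Sum>i\<in>I. m i * (f i)^2)"
    unfolding sum_product by (simp add: sum_subtractf sum_distrib_left)
  finally show ?thesis
    using assms by (simp add: power2_eq_square)
qed

text \<open>Polarization: a quadratic form of this shape determines its coefficients.\<close>

lemma conductance_form_inject:
  fixes c :: "real^2 \<Rightarrow> real^2 \<Rightarrow> real"
  assumes A: "finite A" "x \<in> A" "y \<in> A" "x \<noteq> y"
    and sym: "\<And>x y. c x y = c y x" "\<And>x y. c' x y = c' y x"
    and eq: "\<And>f. conductance_form A c f = conductance_form A c' f"
  shows "c x y = c' x y"
proof -
  have polar: "c x y = - (conductance_form A c (\<lambda>a. of_bool (a = x) + of_bool (a = y))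
      - conductance_form A c (\<lambda>a. of_bool (a = x)) - conductance_form A c (\<lambda>a. of_bool (a = y))) / 2"
    if sym: "\<forall>x y. c x y = c y x" for c
  proof -
    have "conductance_form A c (\<lambda>a. of_bool (a = x) + of_bool (a = y))
      - conductance_form A c (\<lambda>a. of_bool (a = x)) - conductance_form A c (\<lambda>a. of_bool (a = y))
      = (\<Sum>a\<in>A. \<Sum>b\<in>A. c a b * ((of_bool (a = x) - of_bool (b = x)) * (of_bool (a = y) - of_bool (b = y))))"
      unfolding conductance_form_def right_diff_distrib[symmetric] sum_subtractf[symmetric] sum_distrib_left
      by (intro sum.cong refl) (simp add: power2_eq_square algebra_simps)
    \<comment> \<open>The product of indicator differences is \<open>-1\<close> at the ordered pairs
      \<open>(x, y)\<close> and \<open>(y, x)\<close> and \<open>0\<close> elsewhere.\<close>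
    also have "\<dots> = (\<Sum>a\<in>A. \<Sum>b\<in>A. (if a = x then if b = y then - c x y else 0 else 0)
        + (if a = y then if b = x then - c x y else 0 else 0))"
      using A(4) sym[rule_format, of x y] by (intro sum.cong refl) auto
    also have "\<dots> = - 2 * c x y"
    proof -
      have "(\<Sum>a\<in>A. \<Sum>b\<in>A. (if a = u then if b = v then k else 0 else 0)) = k"
        if "u \<in> A" "v \<in> A" for u v and k :: real
      proof -
        have "(\<Sum>a\<in>A. \<Sum>b\<in>A. (if a = u then if b = v then k else 0 else 0))
            = (\<Sum>a\<in>A. if a = u then k else 0)"
          using that A(1) by (intro sum.cong refl) (simp add: sum.delta)
        then show ?thesis using that A(1) by (simp add: sum.delta)
      qed
      from this[OF A(2,3)] this[OF A(3,2)] show ?thesis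
        by (simp add: sum.distrib)
    qed
    finally show ?thesis by simp
  qed
  show ?thesis using polar[of c] polar[of c'] sym eq by simp
qed

text \<open>Attainment together with the matching lower bound identifies the least energy for all
  prescribed values. A form determines its off-diagonal coefficients, which resolves the
  \<open>THE\<close>. The diagonal of \<open>C\<close> is multiplied by zero and may be
  arbitrary.\<close>

lemma conductance_eqI:
  assumes inj: "inj_on g I" and fin: "finite I" and ij: "i \<in> I" "j \<in> I" "i \<noteq> j"
    and sym: "\<And>i j. C i j = C j i"
    and ex: "\<And>f. \<exists>u. u \<in> dom_energy q \<and> (\<forall>i\<in>I. u (g i) = f i) \<and>
        energy q u = ereal ((1/2) * (\<Sum>i\<in>I. \<Sum>j\<in>I. C i j * (f i - f j)^2))"
    and lower: "\<And>v. v \<in> dom_energy q \<Longrightarrow>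
        ereal ((1/2) * (\<Sum>i\<in>I. \<Sum>j\<in>I. C i j * (v (g i) - v (g j))^2)) \<le> energy q v"
  shows "conductance q (g ` I) (g i) (g j) = C i j"
proof -
  define k where "k = the_inv_into I g"
  have k: "k (g i) = i" if "i \<in> I" for i
    using that inj by (simp add: k_def the_inv_into_f_f)
  define c where "c x y = (if x \<in> g ` I \<and> y \<in> g ` I \<and> x \<noteq> y then C (k x) (k y) else 0)" for x y
  have form: "conductance_form (g ` I) c f = (1/2) * (\<Sum>i\<in>I. \<Sum>j\<in>I. C i j * (f (g i) - f (g j))^2)" for f
  proof -
    have summand: "c (g i) (g j) * (f (g i) - f (g j))^2 = C i j * (f (g i) - f (g j))^2" if "i \<in> I" "j \<in> I" for i j
      using that inj_onD[OF inj _ that] by (cases "i = j") (auto simp: c_def k)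
    show ?thesis
      unfolding conductance_form_def sum.reindex[OF inj] o_def by (simp only: summand cong: sum.cong)
  qed
  have c: "conductances_for q (g ` I) c"
    unfolding conductances_for_def
  proof (intro conjI allI impI)
    show "c x y = c y x" for x y using sym by (auto simp: c_def)
    show "c x y = 0" if "x \<notin> g ` I \<or> y \<notin> g ` I \<or> x = y" for x y
      using that by (auto simp: c_def)
    fix f
    obtain u where u: "u \<in> dom_energy q" "\<forall>i\<in>I. u (g i) = f (g i)"
      "energy q u = ereal ((1/2) * (\<Sum>i\<in>I. \<Sum>j\<in>I. C i j * (f (g i) - f (g j))^2))"
      using ex[of "\<lambda>i. f (g i)"] by blast
    have "least_energy_extension q (g ` I) f u"
      unfolding least_energy_extension_def
    proof (intro conjI ballI impI)
      fix v assume "v \<in> dom_energy q" and v: "\<forall>x\<in>g ` I. v x = f x"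
      then show "energy q u \<le> energy q v"
        using lower[of v] u(3) by simp
    qed (use u in auto)
    moreover have "energy q u = ereal (conductance_form (g ` I) c u)"
      unfolding form using u by simp
    ultimately show "\<exists>u. least_energy_extension q (g ` I) f u \<and> energy q u = ereal (conductance_form (g ` I) c u)"
      by blast
  qed
  have uniq: "c' = c" if c': "conductances_for q (g ` I) c'" for c'
  proof -
    have restrict: "conductance_form (g ` I) c u = conductance_form (g ` I) c f"
      if "least_energy_extension q (g ` I) f u" for c f u
    proof -
      have "u x = f x" if "x \<in> g ` I" for x
        using that \<open>least_energy_extension q (g ` I) f u\<close> unfolding least_energy_extension_def by blast
      then show ?thesis
        unfolding conductance_form_def by (intro arg_cong[where f="\<lambda>s. 1/2 * s"] sum.cong refl) simp
    qed
    have eq: "conductance_form (g ` I) c' f = conductance_form (g ` I) c f" for f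
    proof -
      obtain u where u: "least_energy_extension q (g ` I) f u" "energy q u = ereal (conductance_form (g ` I) c u)"
        using c unfolding conductances_for_def by blast
      obtain u' where u': "least_energy_extension q (g ` I) f u'" "energy q u' = ereal (conductance_form (g ` I) c' u')"
        using c' unfolding conductances_for_def by blast
      \<comment> \<open>Each of the two minimizers is a competitor for the other.\<close>
      have "energy q u = energy q u'"
        using u(1) u'(1) unfolding least_energy_extension_def by (intro antisym) auto
      then show ?thesis using u u' restrict by simp
    qed
    show "c' = c"
    proof (intro ext)
      fix x y
      show "c' x y = c x y"
      proof (cases "x \<in> g ` I \<and> y \<in> g ` I \<and> x \<noteq> y")
        case True
        have "\<And>x y. c' x y = c' y x" "\<And>x y. c x y = c y x"
          using c c' unfolding conductances_for_def by blast+
        then show ?thesis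
          using conductance_form_inject[of "g ` I" x y c' c] True fin eq by blast
      next
        case False
        then show ?thesis using c c' unfolding conductances_for_def by metis
      qed
    qed
  qed
  have "conductance q (g ` I) = c"
    unfolding conductance_def using c uniq by (rule the_equality)
  then show ?thesis
    using ij inj k by (auto simp: c_def inj_on_def)
qed

section \<open>Recursive forms for the bottom row and their coefficients\<close>

primrec top_cond :: "nat \<Rightarrow> real" where
  "top_cond 0 = 2"
| "top_cond (Suc n) = (10/3) * top_cond n / (1 + top_cond n)"

text \<open>The value zero beyond \<open>2^n\<close> matters because \<open>right_half\<close> has
  no upper cutoff: the halving recursion of the weights then holds at every index.\<close>

definition trap_weight :: "nat \<Rightarrow> nat \<Rightarrow> real" where
  "trap_weight n i = (if i > 2^n then 0 else if i = 0 \<or> i = 2^n then 1 / 2^(n+1) else 1 / 2^n)"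

definition trap_mean :: "nat \<Rightarrow> (nat \<Rightarrow> real) \<Rightarrow> real" where
  "trap_mean n f = (\<Sum>i\<le>2^n. trap_weight n i * f i)"

text \<open>Extension by zero turns sums over a half row into sums over the whole row. The midpoint
  \<open>2^n\<close> belongs to both halves.\<close>

definition left_half :: "nat \<Rightarrow> (nat \<Rightarrow> real) \<Rightarrow> nat \<Rightarrow> real" where
  "left_half n f i = (if i \<le> 2^n then f i else 0)"

definition right_half :: "nat \<Rightarrow> (nat \<Rightarrow> real) \<Rightarrow> nat \<Rightarrow> real" where
  "right_half n f i = (if 2^n \<le> i then f (i - 2^n) else 0)"

lemma sum_left: "(\<Sum>i\<le>2^Suc n. left_half n f i * g i) = (\<Sum>i\<le>2^n. f i * g i)"
proof -
  have "(\<Sum>i\<le>2^n. f i * g i) = (\<Sum>i\<le>2^n. left_half n f i * g i)"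
    by (intro sum.cong) (auto simp: left_half_def)
  also have "\<dots> = (\<Sum>i\<le>2^Suc n. left_half n f i * g i)"
    by (intro sum.mono_neutral_left) (auto simp: left_half_def)
  finally show ?thesis ..
qed

lemma sum_right: "(\<Sum>i\<le>2^Suc n. right_half n f i * g i) = (\<Sum>i\<le>2^n. f i * g (2^n + i))"
proof -
  have "(\<Sum>i\<le>2^n. f i * g (2^n + i)) = (\<Sum>i\<in>(+) (2^n) ` {..2^n}. right_half n f i * g i)"
    by (subst sum.reindex) (auto simp: right_half_def)
  also have "\<dots> = (\<Sum>i\<le>2^Suc n. right_half n f i * g i)"
  proof (intro sum.mono_neutral_left ballI)
    fix i :: nat assume "i \<in> {..2^Suc n} - (+) (2^n) ` {..2^n}"
    moreover have "i \<in> (+) (2^n) ` {..2^n}" if "2^n \<le> i" "i \<le> 2^Suc n"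
      using that by (intro image_eqI[of _ _ "i - 2^n"]) auto
    ultimately show "right_half n f i * g i = 0"
      by (auto simp: right_half_def)
  qed auto
  finally show ?thesis ..
qed

lemma trap_weight_Suc:
  "trap_weight (Suc n) i = (left_half n (trap_weight n) i + right_half n (trap_weight n) i) / 2"
proof -
  have "i > 2 * 2^n \<longleftrightarrow> i - 2^n > (2::nat)^n" "i = 2 * 2^n \<longleftrightarrow> i - 2^n = (2::nat)^n"
    by auto
  then show ?thesis
    by (auto simp: trap_weight_def left_half_def right_half_def)
qed

lemma trap_mean_Suc:
  "trap_mean (Suc n) f = (trap_mean n f + trap_mean n (\<lambda>i. f (2^n + i))) / 2"
  unfolding trap_mean_def trap_weight_Suc
  by (simp add: sum_left[unfolded power_Suc] sum_right[unfolded power_Suc] add_divide_distrib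
     sum.distrib distrib_right sum_divide_distrib[symmetric])

lemma sum_trap_weight: "(\<Sum>i\<le>2^n. trap_weight n i) = 1"
proof -
  have "trap_mean n (\<lambda>_. 1) = 1"
    by (induction n) (simp_all add: trap_mean_Suc, simp add: trap_mean_def trap_weight_def)
  then show ?thesis by (simp add: trap_mean_def)
qed

text \<open>The base values come from a triangle of unit conductances: the two edges at the top act
  in parallel between the top and the row, giving \<open>top_cond 0 = 2\<close>, and in series
  between the bottom corners, giving \<open>1/2\<close> in addition to the bottom edge, hence
  \<open>3/2\<close>.\<close>

primrec row_form :: "nat \<Rightarrow> (nat \<Rightarrow> real) \<Rightarrow> real" where
  "row_form 0 f = (3/2) * (f 0 - f 1)^2"
| "row_form (Suc n) f = (5/3) * (row_form n f + row_form n (\<lambda>i. f (2^n + i)))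
     + (5/2) * top_cond n / (3 + top_cond n) * (trap_mean n f - trap_mean n (\<lambda>i. f (2^n + i)))^2"

definition top_form :: "nat \<Rightarrow> (nat \<Rightarrow> real) \<Rightarrow> real \<Rightarrow> real" where
  "top_form n f t = row_form n f + top_cond n * (t - trap_mean n f)^2"

lemma top_cond_pos: "top_cond n > 0"
  by (induction n) (auto intro!: divide_pos_pos)

text \<open>The reciprocals satisfy \<open>s' = (3/10) * (1 + s)\<close>, with fixed point
  \<open>3/7\<close>; the initial deviation from it is \<open>1/2 - 3/7 = 1/14\<close>.\<close>

lemma top_cond_inverse: "1 / top_cond n = 3/7 + (1/14) * (3/10)^n"
proof (induction n)
  case (Suc n)
  have "1 / top_cond (Suc n) = (3/10) * (1 + 1 / top_cond n)"
    using top_cond_pos[of n] by (simp add: field_simps)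
  then show ?case unfolding Suc by (simp add: field_simps)
qed simp

text \<open>The two branches of \<open>row_cond (Suc n)\<close> overlap in the midpoint \<open>2^n\<close> only.\<close>

primrec row_cond :: "nat \<Rightarrow> nat \<Rightarrow> nat \<Rightarrow> real" where
  "row_cond 0 i j = 3/2"
| "row_cond (Suc n) i j =
     (5/3) * ((if i \<le> 2^n \<and> j \<le> 2^n then row_cond n i j else 0)
            + (if 2^n \<le> i \<and> 2^n \<le> j then row_cond n (i - 2^n) (j - 2^n) else 0))
     - (5/2) * top_cond n / (3 + top_cond n)
       * ((left_half n (trap_weight n) i - right_half n (trap_weight n) i)
        * (left_half n (trap_weight n) j - right_half n (trap_weight n) j))"

lemma row_cond_sym: "row_cond n i j = row_cond n j i"
  by (induction n arbitrary: i j) auto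

lemma row_form_eq:
  "row_form n f = (1/2) * (\<Sum>i\<le>2^n. \<Sum>j\<le>2^n. row_cond n i j * (f i - f j)^2)"
proof (induction n arbitrary: f)
  case 0
  show ?case by (simp add: power2_commute[of "f (Suc 0)"])
next
  case (Suc n)
  \<comment> \<open>The functional with coefficients \<open>?m\<close> is the difference of the two
    half means. Both halves have the same total weight, so the coefficients sum to zero and
    \<open>square_zero_sum\<close> applies.\<close>
  let ?m = "\<lambda>i. left_half n (trap_weight n) i - right_half n (trap_weight n) i"
  let ?N = "2^Suc n :: nat"
  define T where "T = (5/2) * top_cond n / (3 + top_cond n)"
  have m0: "sum ?m {..?N} = 0"
    using sum_left[of n "trap_weight n" "\<lambda>_. 1"] sum_right[of n "trap_weight n" "\<lambda>_. 1"]
    by (simp add: sum_subtractf)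
  have mf: "(\<Sum>i\<le>?N. ?m i * f i) = trap_mean n f - trap_mean n (\<lambda>i. f (2^n + i))"
    unfolding trap_mean_def left_diff_distrib sum_subtractf sum_left sum_right ..
  have L: "(\<Sum>i\<le>?N. \<Sum>j\<le>?N. (if i \<le> 2^n \<and> j \<le> 2^n then row_cond n i j else 0) * (f i - f j)^2)
     = (\<Sum>i\<le>2^n. \<Sum>j\<le>2^n. row_cond n i j * (f i - f j)^2)"
  proof -
    \<comment> \<open>\<open>left_half\<close> of the constant \<open>1\<close> is the indicator of
      the left half; in this shape \<open>sum_left\<close> applies to each of the two sums.\<close>
    have "(\<Sum>i\<le>?N. \<Sum>j\<le>?N. (if i \<le> 2^n \<and> j \<le> 2^n then row_cond n i j else 0) * (f i - f j)^2)
      = (\<Sum>i\<le>?N. left_half n (\<lambda>i. 1) i * (\<Sum>j\<le>?N. left_half n (row_cond n i) j * (f i - f j)^2))"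
      unfolding sum_distrib_left by (intro sum.cong refl) (auto simp: left_half_def)
    then show ?thesis unfolding sum_left by simp
  qed
  have R: "(\<Sum>i\<le>?N. \<Sum>j\<le>?N. (if 2^n \<le> i \<and> 2^n \<le> j then row_cond n (i - 2^n) (j - 2^n) else 0) * (f i - f j)^2)
     = (\<Sum>i\<le>2^n. \<Sum>j\<le>2^n. row_cond n i j * (f (2^n + i) - f (2^n + j))^2)"
  proof -
    have "(\<Sum>i\<le>?N. \<Sum>j\<le>?N. (if 2^n \<le> i \<and> 2^n \<le> j then row_cond n (i - 2^n) (j - 2^n) else 0) * (f i - f j)^2)
      = (\<Sum>i\<le>?N. right_half n (\<lambda>i. 1) i * (\<Sum>j\<le>?N. right_half n (row_cond n (i - 2^n)) j * (f i - f j)^2))"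
      unfolding sum_distrib_left by (intro sum.cong refl) (auto simp: right_half_def)
    then show ?thesis unfolding sum_right by simp
  qed
  have expand: "(1/2) * (((5/3) * (a + b) - T * (m * k)) * s)
      = (5/3) * ((1/2) * (a * s) + (1/2) * (b * s)) + T * ((1/2) * (- (m * k) * s))" for a b m k s
    by (simp add: field_simps)
  have "(1/2) * (\<Sum>i\<le>?N. \<Sum>j\<le>?N. row_cond (Suc n) i j * (f i - f j)^2)
    = (5/3) * ((1/2) * (\<Sum>i\<le>?N. \<Sum>j\<le>?N. (if i \<le> 2^n \<and> j \<le> 2^n then row_cond n i j else 0) * (f i - f j)^2)
       + (1/2) * (\<Sum>i\<le>?N. \<Sum>j\<le>?N. (if 2^n \<le> i \<and> 2^n \<le> j then row_cond n (i - 2^n) (j - 2^n) else 0) * (f i - f j)^2))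
      + T * ((1/2) * (\<Sum>i\<le>?N. \<Sum>j\<le>?N. - (?m i * ?m j) * (f i - f j)^2))"
    unfolding sum_distrib_left sum.distrib[symmetric] row_cond.simps T_def[symmetric]
    by (intro sum.cong refl expand)
  also have "\<dots> = row_form (Suc n) f"
    unfolding L R square_zero_sum[OF m0, symmetric] mf Suc.IH[symmetric] by (simp add: T_def)
  finally show ?case ..
qed

text \<open>For indices strictly on opposite sides of the midpoint both recursive summands vanish,
  and the coupling of the two half means is all that remains. An endpoint carries half the weight of
  an interior point, whence the factors \<open>1\<close> and \<open>2\<close>.\<close>

lemma row_cond_cross:
  assumes "i < 2^n" "2^n < j" "j \<le> 2^Suc n"
  shows "row_cond (Suc n) i j
    = 35 * 5^Suc n / (10 * 6^Suc n + 32 * 20^Suc n) * (if i = 0 then 1 else 2) * (if j = 2^Suc n then 1 else 2)"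
proof -
  have pow: "(20::real)^n = 5^n * 4^n" "(6::real)^n = 20^n * (3/10)^n" "(4::real)^n = 2^n * 2^n"
    by (simp_all flip: power_mult_distrib)
  have pos: "(3/10::real)^n > 0" by simp
  \<comment> \<open>With \<open>1 / top_cond n\<close> inserted, the denominator
    \<open>3 / top_cond n + 1\<close> equals \<open>(32 + 3 * (3/10)^n) / 14\<close>.\<close>
  have "(5/2) * top_cond n / (3 + top_cond n) = (5/2) / (3 * (1 / top_cond n) + 1)"
    using top_cond_pos[of n] by (simp add: divide_simps)
  also have "\<dots> = 35 / (32 + 3 * (3/10)^n)"
    unfolding top_cond_inverse using pos by (simp add: divide_simps)
  finally have T: "(5/2) * top_cond n / (3 + top_cond n) = 35 / (32 + 3 * (3/10)^n)" .
  have wi: "left_half n (trap_weight n) i - right_half n (trap_weight n) i = (if i = 0 then 1 else 2) / (2 * 2^n)"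
    using assms by (auto simp: left_half_def right_half_def trap_weight_def)
  have wj: "left_half n (trap_weight n) j - right_half n (trap_weight n) j = - (if j = 2^Suc n then 1 else 2) / (2 * 2^n)"
    using assms by (auto simp: left_half_def right_half_def trap_weight_def)
  have "row_cond (Suc n) i j = 35 / (32 + 3 * (3/10)^n) * ((if i = 0 then 1 else 2) * (if j = 2^Suc n then 1 else 2)) / (4 * 4^n)"
    unfolding row_cond.simps T wi wj using assms by (simp add: pow)
  \<comment> \<open>By \<open>6^n = 20^n * (3/10)^n\<close> and \<open>20^n = 5^n * 4^n\<close> the
    denominator contains the factor \<open>5^Suc n\<close>, which cancels.\<close>
  moreover have "35 * 5^Suc n / (10 * 6^Suc n + 32 * 20^Suc n) = 35 / (32 + 3 * (3/10)^n) / (4 * (4::real)^n)"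
  proof -
    have "10 * 6^Suc n + 32 * 20^Suc n = 5^Suc n * (4 * 4^n * (32 + 3 * (3/10::real)^n))"
      unfolding power_Suc pow by (simp add: algebra_simps)
    then show ?thesis by simp
  qed
  ultimately show ?thesis by (simp del: power_Suc)
qed

subsection \<open>Barycentric coordinates and the gasket\<close>

text \<open>Barycentric coordinates with respect to \<open>q 0\<close>, \<open>q 1\<close>, \<open>q 2\<close> only if these are the vertices of
  an equilateral triangle.\<close>

definition bary :: "(nat \<Rightarrow> real^2) \<Rightarrow> nat \<Rightarrow> real^2 \<Rightarrow> real" where
  "bary q k x = 1/3 + 2 / (dist (q 0) (q 1))^2
     * ((x - (1/3) *\<^sub>R (q 0 + q 1 + q 2)) \<bullet> (q k - (1/3) *\<^sub>R (q 0 + q 1 + q 2)))"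

lemma continuous_on_bary [continuous_intros]: "continuous_on S (bary q k)"
  unfolding bary_def by (intro continuous_intros)

lemma bary_midpoint: "bary q k ((1/2) *\<^sub>R (x + y)) = (bary q k x + bary q k y) / 2"
proof -
  define c where "c = (1/3) *\<^sub>R (q 0 + q 1 + q 2)"
  have "(1/2) *\<^sub>R (x + y) - c = (1/2) *\<^sub>R ((x - c) + (y - c))"
    by (simp add: vec_eq_iff field_simps)
  then have *: "((1/2) *\<^sub>R (x + y) - c) \<bullet> z = ((x - c) \<bullet> z + (y - c) \<bullet> z) / 2" for z
    by (simp only: inner_scaleR_left inner_add_left)
  have "1/3 + d * ((a + b) / 2) = (1/3 + d * a + (1/3 + d * b)) / 2" for a b d :: real
    by (simp add: field_simps)
  then show ?thesis
    unfolding bary_def c_def[symmetric] * .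
qed

text \<open>The vectors from the centroid to the three vertices add up to zero, so only the
  constants \<open>1/3\<close> survive.\<close>

lemma sum_bary: "bary q 0 x + bary q 1 x + bary q 2 x = 1"
proof -
  define c where "c = (1/3) *\<^sub>R (q 0 + q 1 + q 2)"
  define d where "d = 2 / (dist (q 0) (q 1))^2"
  have "(q 0 - c) + (q 1 - c) + (q 2 - c) = 0"
    by (simp add: c_def vec_eq_iff field_simps)
  then have "(x - c) \<bullet> (q 0 - c) + (x - c) \<bullet> (q 1 - c) + (x - c) \<bullet> (q 2 - c) = 0"
    unfolding inner_add_right[symmetric] by simp
  then have "d * ((x - c) \<bullet> (q 0 - c) + (x - c) \<bullet> (q 1 - c) + (x - c) \<bullet> (q 2 - c)) = 0"
    by simp
  then show ?thesis
    unfolding bary_def c_def[symmetric] d_def[symmetric] distrib_left by linarith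
qed

text \<open>The representation of \<open>x\<close> by its own coordinates is part of the definition,
  so that boundedness and the recovery of a point from its coordinates are immediate.\<close>

definition big_triangle :: "(nat \<Rightarrow> real^2) \<Rightarrow> (real^2) set" where
  "big_triangle q = {x. (\<forall>k<3. 0 \<le> bary q k x) \<and> x = (\<Sum>k<3. bary q k x *\<^sub>R q k)}"

lemma bary_le_1: "x \<in> big_triangle q \<Longrightarrow> k < 3 \<Longrightarrow> bary q k x \<le> 1"
proof -
  assume x: "x \<in> big_triangle q" and k: "k < 3"
  have "0 \<le> bary q 0 x" "0 \<le> bary q 1 x" "0 \<le> bary q 2 x"
    using x by (auto simp: big_triangle_def)
  then show ?thesis
    using k sum_bary[of q x] unfolding less_3_cases by (elim disjE) simp_all
qed

lemma dist_F: "dist (F q i x) (F q i y) = dist x y / 2"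
proof -
  have "F q i x - F q i y = (1/2) *\<^sub>R (x - y)" by (simp add: F_def algebra_simps)
  then show ?thesis by (simp add: dist_norm)
qed

lemma inj_F: "inj (F q i)"
  by (rule injI) (simp add: F_def)

lemma continuous_on_F [continuous_intros]: "continuous_on S (F q i)"
  unfolding F_def by (intro continuous_intros)

lemma F_vertex: "F q i (q i) = q i"
  by (simp add: F_def flip: scaleR_2)

lemma F_vertex_commute: "F q i (q j) = F q j (q i)"
  by (simp add: F_def add.commute)

lemma F_image_closure: "F q i ` closure S = closure (F q i ` S)"
proof -
  have F: "F q i ` S = (\<lambda>x. (1/2) *\<^sub>R q i + x) ` ((*\<^sub>R) (1/2) ` S)" for S
    by (auto simp: F_def image_image algebra_simps)
  show ?thesis unfolding F by (simp only: closure_translation closure_scaleR)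
qed

text \<open>Let \<open>x = F q i y\<close> be a point of \<open>K\<close> farthest from
  \<open>L\<close>. Since \<open>F q i\<close> maps \<open>L\<close> into \<open>L\<close> and
  halves distances, the maximal distance is at most half of itself, hence zero. Used in both
  directions, this gives uniqueness of the attractor.\<close>

lemma attractor_subset:
  assumes K: "compact K" "K = (\<Union>i<3. F q i ` K)"
    and L: "compact L" "L \<noteq> {}" "L = (\<Union>i<3. F q i ` L)"
  shows "K \<subseteq> L"
proof (cases "K = {}")
  case False
  have "continuous_on K (\<lambda>x. infdist x L)"
    by (intro continuous_intros)
  then obtain x where x: "x \<in> K" "\<And>y. y \<in> K \<Longrightarrow> infdist y L \<le> infdist x L"
    using continuous_attains_sup[OF K(1) False] by blast
  then obtain i y where y: "i < 3" "y \<in> K" "x = F q i y"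
    using K(2) by blast
  obtain z where z: "z \<in> L" "infdist y L = dist y z"
    using infdist_attains_inf[of L y] L compact_imp_closed by blast
  have "F q i z \<in> L" using L(3) y(1) z(1) by blast
  then have "infdist x L \<le> dist y z / 2"
    using infdist_le[of "F q i z" L x] by (simp add: y dist_F)
  then have "infdist x L \<le> 0"
    using x(2)[OF y(2)] z(2) by simp
  then have "infdist y L = 0" if "y \<in> K" for y
    using x(2)[OF that] infdist_nonneg[of y L] by simp
  then show ?thesis
    using in_closed_iff_infdist_zero[of L] L compact_imp_closed by blast
qed auto

section \<open>Edges, triangle energies and the harmonic rule\<close>

definition edges :: "(nat \<Rightarrow> real^2) \<Rightarrow> nat \<Rightarrow> ((real^2) \<times> (real^2)) set" where
  "edges q m = {(x, y). adj q m x y}"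

lemma graph_energy_edges:
  "graph_energy q m u = (5/3)^m * ((1/2) * (\<Sum>(x,y)\<in>edges q m. (u x - u y)^2))"
  by (simp add: graph_energy_def edges_def)

lemma finite_words: "finite (words m)"
  unfolding words_def using finite_lists_length_eq[of "{..<3::nat}" m] by (simp add: conj_commute)

lemma words_0: "words 0 = {[]}"
  by (auto simp: words_def)

lemma words_Suc: "words (Suc m) = (\<Union>i<3. (#) i ` words m)"
  by (auto simp: words_def length_Suc_conv)

lemma finite_edges: "finite (edges q m)"
proof -
  have "edges q m \<subseteq> (\<Union>w\<in>words m. (Fw q w ` V q 0) \<times> (Fw q w ` V q 0))"
    by (auto simp: edges_def adj_def)
  then show ?thesis by (rule finite_subset) (auto simp: finite_words)
qed

lemma Fw_Cons_image: "Fw q (i # w) ` S = F q i ` Fw q w ` S"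
  by (simp add: Fw_def image_comp)

lemma edges_Suc: "edges q (Suc m) = (\<Union>i<3. map_prod (F q i) (F q i) ` edges q m)"
proof (intro subset_antisym subrelI)
  fix x y assume "(x, y) \<in> edges q (Suc m)"
  then obtain i w where "x \<noteq> y" "i < 3" "w \<in> words m"
    "x \<in> Fw q (i # w) ` V q 0" "y \<in> Fw q (i # w) ` V q 0"
    by (auto simp: edges_def adj_def words_Suc simp del: V.simps)
  then obtain x' y' where x': "x' \<in> Fw q w ` V q 0" "y' \<in> Fw q w ` V q 0" "x = F q i x'" "y = F q i y'"
    unfolding Fw_Cons_image by blast
  then have "(x', y') \<in> edges q m"
    using \<open>x \<noteq> y\<close> \<open>w \<in> words m\<close> unfolding edges_def adj_def by blast
  then show "(x, y) \<in> (\<Union>i<3. map_prod (F q i) (F q i) ` edges q m)"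
    using \<open>i < 3\<close> by (intro UN_I[of i] image_eqI[of _ _ "(x', y')"]) (simp_all add: x')
next
  fix x y assume "(x, y) \<in> (\<Union>i<3. map_prod (F q i) (F q i) ` edges q m)"
  then obtain i x' y' w where i: "i < 3" "x = F q i x'" "y = F q i y'" "x' \<noteq> y'"
    "w \<in> words m" "x' \<in> Fw q w ` V q 0" "y' \<in> Fw q w ` V q 0"
    by (auto simp: edges_def adj_def simp del: V.simps)
  then have "x \<noteq> y" "i # w \<in> words (Suc m)" "x \<in> Fw q (i # w) ` V q 0" "y \<in> Fw q (i # w) ` V q 0"
    by (auto simp: words_Suc Fw_Cons_image inj_eq[OF inj_F] simp del: V.simps)
  then show "(x, y) \<in> edges q (Suc m)" unfolding edges_def adj_def by blast
qed

definition tri_energy :: "(nat \<Rightarrow> real) \<Rightarrow> real" where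
  "tri_energy h = (h 0 - h 1)^2 + (h 1 - h 2)^2 + (h 2 - h 0)^2"

text \<open>The map \<open>x \<mapsto> 2 x - q i\<close> is the inverse of \<open>F q i\<close>.\<close>

definition glue :: "(nat \<Rightarrow> real^2) \<Rightarrow> (nat \<Rightarrow> real^2 \<Rightarrow> real) \<Rightarrow> real^2 \<Rightarrow> real" where
  "glue q us x = (let i = (LEAST i. i = 2 \<or> bary q i x \<ge> 1/2) in us i (2 *\<^sub>R x - q i))"

definition compatible :: "(nat \<Rightarrow> real^2) \<Rightarrow> (nat \<Rightarrow> real^2 \<Rightarrow> real) \<Rightarrow> bool" where
  "compatible q us \<longleftrightarrow> (\<forall>i<3. \<forall>j<3. us i (q j) = us j (q i))"

text \<open>The values at the corners of the cell \<open>i\<close> of the harmonic function with boundary values \<open>h\<close>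
  (the \<open>1/5\<close>--\<open>2/5\<close> rule).\<close>

definition cell_bdry :: "(nat \<Rightarrow> real) \<Rightarrow> nat \<Rightarrow> nat \<Rightarrow> real" where
  "cell_bdry h i j = (if i = j then h i else (h i + h j + (h 0 + h 1 + h 2)) / 5)"

text \<open>The harmonic rule is applied down to level \<open>k\<close>, followed by affine
  interpolation in the cells of that level.\<close>

primrec harmonic_approx :: "(nat \<Rightarrow> real^2) \<Rightarrow> nat \<Rightarrow> (nat \<Rightarrow> real) \<Rightarrow> real^2 \<Rightarrow> real" where
  "harmonic_approx q 0 = (\<lambda>h x. \<Sum>j<3. bary q j x * h j)"
| "harmonic_approx q (Suc k) = (\<lambda>h. glue q (\<lambda>i. harmonic_approx q k (cell_bdry h i)))"

text \<open>A corner and an adjacent junction differ by terms such as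
  \<open>(2 * (h 0 - h 1) + (h 0 - h 2)) / 5\<close>, and two junctions by a fifth of a difference.
  The factor \<open>3/5\<close> yields geometric convergence of the approximations.\<close>

lemma cell_bdry_osc:
  assumes "\<And>i j. i < 3 \<Longrightarrow> j < 3 \<Longrightarrow> \<bar>h i - h j\<bar> \<le> D" "k < 3" "i < 3" "j < 3"
  shows "\<bar>cell_bdry h k i - cell_bdry h k j\<bar> \<le> (3/5) * D"
proof -
  have D: "h i \<le> D + h j" if "i < 3" "j < 3" for i j
    using abs_le_D1[OF assms(1)[OF that]] by simp
  have D: "h 0 \<le> D + h 1" "h 1 \<le> D + h 0" "h 1 \<le> D + h 2" "h 2 \<le> D + h 1" "h 0 \<le> D + h 2"
    "h 2 \<le> D + h 0" "h 0 \<le> D + h 0"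
    by (rule D; simp)+
  have cell: "cell_bdry h 0 0 = h 0" "cell_bdry h 1 1 = h 1" "cell_bdry h 2 2 = h 2"
    "cell_bdry h 0 1 = 2/5 * h 0 + 2/5 * h 1 + 1/5 * h 2" "cell_bdry h 1 0 = 2/5 * h 0 + 2/5 * h 1 + 1/5 * h 2"
    "cell_bdry h 0 2 = 2/5 * h 0 + 1/5 * h 1 + 2/5 * h 2" "cell_bdry h 2 0 = 2/5 * h 0 + 1/5 * h 1 + 2/5 * h 2"
    "cell_bdry h 1 2 = 1/5 * h 0 + 2/5 * h 1 + 2/5 * h 2" "cell_bdry h 2 1 = 1/5 * h 0 + 2/5 * h 1 + 2/5 * h 2"
    by (simp_all add: cell_bdry_def add_divide_distrib)
  have "cell_bdry h k i - cell_bdry h k j \<le> (3/5) * D" if "i < 3" "j < 3" for i j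
    using that assms(2) unfolding less_3_cases by (elim disjE; hypsubst; unfold cell; insert D; linarith)
  from this[OF assms(3,4)] this[OF assms(4,3)] show ?thesis
    by (simp only: abs_le_iff minus_diff_eq)
qed

text \<open>Completing the square around the harmonic junction values: \<open>d\<close> measures the
  deviation from them at the three junctions. The remainder is nonnegative, which gives monotonicity
  under refinement, and zero for \<open>d = 0\<close>, which gives conservation for harmonic
  functions.\<close>

lemma sum_tri_energy_cells:
  fixes h :: "nat \<Rightarrow> real"
  assumes "\<And>i. i < 3 \<Longrightarrow> k i i = h i" "\<And>i j. i < 3 \<Longrightarrow> j < 3 \<Longrightarrow> k i j = k j i"
  defines "d \<equiv> \<lambda>i j. k i j - cell_bdry h i j"
  shows "(5/3) * (\<Sum>i<3. tri_energy (k i)) = tri_energy h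
      + (5/3) * (2 * (d 1 2)^2 + 2 * (d 0 2)^2 + 2 * (d 0 1)^2
         + (d 1 2 - d 0 2)^2 + (d 0 2 - d 0 1)^2 + (d 0 1 - d 1 2)^2)"
proof -
  define x y z where "x = d 1 2" and "y = d 0 2" and "z = d 0 1"
  have k: "k 0 0 = h 0" "k 1 1 = h 1" "k 2 2 = h 2" "k 1 2 = x + (h 0 + 2 * h 1 + 2 * h 2) / 5"
    "k 0 2 = y + (2 * h 0 + h 1 + 2 * h 2) / 5" "k 0 1 = z + (2 * h 0 + 2 * h 1 + h 2) / 5"
    "k 2 1 = x + (h 0 + 2 * h 1 + 2 * h 2) / 5" "k 2 0 = y + (2 * h 0 + h 1 + 2 * h 2) / 5"
    "k 1 0 = z + (2 * h 0 + 2 * h 1 + h 2) / 5"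
    using assms(1,2) by (auto simp: x_def y_def z_def d_def cell_bdry_def field_simps)
  show ?thesis
    unfolding x_def[symmetric] y_def[symmetric] z_def[symmetric] sum_lessThan_3 tri_energy_def k
    by (simp add: power2_eq_square field_simps)
qed

lemma tri_energy_le:
  assumes "\<And>i. i < 3 \<Longrightarrow> k i i = h i" "\<And>i j. i < 3 \<Longrightarrow> j < 3 \<Longrightarrow> k i j = k j i"
  shows "tri_energy h \<le> (5/3) * (\<Sum>i<3. tri_energy (k i))"
  by (subst sum_tri_energy_cells[OF assms]) simp_all

lemma cell_bdry_commute: "cell_bdry h i j = cell_bdry h j i"
  by (simp add: cell_bdry_def add.commute)

lemma cell_bdry_self: "cell_bdry h i i = h i"
  by (simp add: cell_bdry_def)

lemma tri_energy_cell_bdry: "(5/3) * (\<Sum>i<3. tri_energy (cell_bdry h i)) = tri_energy h"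
  using sum_tri_energy_cells[of "cell_bdry h" h] cell_bdry_commute[of h] cell_bdry_self[of h] by simp

lemma energy_eventually_const:
  assumes "\<And>m. m \<ge> N \<Longrightarrow> graph_energy q m u = E"
  shows "energy q u = ereal E"
  unfolding energy_def
  by (intro limI tendsto_eventually) (auto simp: eventually_sequentially assms intro!: exI[of _ N])

section \<open>Row subdivision and elimination of the corners of the top cell\<close>

lemma row_pt_Suc:
  shows "row_pt q (Suc n) i = F q 1 (row_pt q n i)"
    and "row_pt q (Suc n) (2^n + i) = F q 2 (row_pt q n i)"
proof -
  have "real (2^n + i) / 2^Suc n = 1/2 + real i / 2^n / 2"
    by (simp add: field_simps)
  then show "row_pt q (Suc n) (2^n + i) = F q 2 (row_pt q n i)"
    by (simp add: row_pt_def F_def vec_eq_iff field_simps)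
  show "row_pt q (Suc n) i = F q 1 (row_pt q n i)"
    by (simp add: row_pt_def F_def vec_eq_iff field_simps)
qed

lemma row_index_cases:
  fixes i :: nat
  assumes "i \<le> 2^Suc n"
  obtains "i \<le> 2^n" | j where "j \<le> 2^n" "i = 2^n + j"
proof (cases "i \<le> 2^n")
  case False
  then have "i - 2^n \<le> 2^n" "i = 2^n + (i - 2^n)" using assms by auto
  then show ?thesis using that(2) by blast
qed (use that(1) in blast)

text \<open>Series connection: completing the square in the potential \<open>p\<close> of the middle node.\<close>

lemma series_square:
  fixes a S :: real
  assumes "a > 0" "S > 0"
  shows "a * (t - p)^2 + S * (p - m)^2
     = a * S / (a + S) * (t - m)^2 + (a + S) * (p - (a * t + S * m) / (a + S))^2"
proof -
  define r where "r = p - (a * t + S * m) / (a + S)"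
  have p: "p = r + (a * t + S * m) / (a + S)" by (simp add: r_def)
  have 1: "t - p = S / (a + S) * (t - m) - r" "p - m = a / (a + S) * (t - m) + r"
    using assms by (simp_all add: p field_simps)
  define k where "k = 1 / (a + S)"
  have k: "a * k + S * k = 1" using assms unfolding distrib_right[symmetric] k_def by simp
  have "a * (S * k * (t - m) - r)^2 + S * (a * k * (t - m) + r)^2
     = a * S * k * (a * k + S * k) * (t - m)^2 + (a + S) * r^2"
    by (simp add: power2_eq_square algebra_simps)
  then show ?thesis unfolding 1 r_def[symmetric] k by (simp add: k_def)
qed

text \<open>In the coordinates \<open>(x + y) / 2\<close> and \<open>(x - y) / 2\<close> the energy
  decouples into two series connections, of \<open>1\<close> with \<open>S\<close> and of
  \<open>3\<close> with \<open>S\<close>; in the \<open>3\<close>, the edge between the corners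
  contributes \<open>2\<close> and the edges to the top contribute \<open>1\<close>. The leftover
  squares vanish at the optimal \<open>x\<close> and \<open>y\<close>.\<close>

lemma top_form_Suc:
  fixes f n
  defines "S \<equiv> top_cond n" and "l \<equiv> trap_mean n f" and "r \<equiv> trap_mean n (\<lambda>i. f (2^n + i))"
  shows "(5/3) * ((t - x)^2 + (x - y)^2 + (y - t)^2 + top_form n f x + top_form n (\<lambda>i. f (2^n + i)) y)
    = top_form (Suc n) f t
      + (10/3) * ((1 + S) * ((x + y) / 2 - (t + S * ((l + r) / 2)) / (1 + S))^2
                + (3 + S) * ((x - y) / 2 - S * ((l - r) / 2) / (3 + S))^2)"
proof -
  have S: "S > 0" by (simp add: S_def top_cond_pos)
  have *: "(t - x)^2 + (x - y)^2 + (y - t)^2 + S * (x - l)^2 + S * (y - r)^2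
     = 2 * (1 * (t - (x + y) / 2)^2 + S * ((x + y) / 2 - (l + r) / 2)^2)
     + 2 * (3 * (0 - (x - y) / 2)^2 + S * ((x - y) / 2 - (l - r) / 2)^2)"
    by (simp add: power2_eq_square field_simps)
  have "top_cond (Suc n) * (t - (l + r) / 2)^2 = (5/3) * (2 * (1 * S / (1 + S) * (t - (l + r) / 2)^2))"
    by (simp add: S_def)
  \<comment> \<open>The constant is \<open>(5/3) * 2 * 3 / 4\<close>, where \<open>1/4\<close> comes
    from halving \<open>l - r\<close>.\<close>
  moreover have "(5/2) * S / (3 + S) * (l - r)^2 = (5/3) * (2 * (3 * S / (3 + S) * (0 - (l - r) / 2)^2))"
    using S by (simp add: divide_simps) (simp add: power2_eq_square algebra_simps)
  ultimately have "top_form (Suc n) f t = (5/3) * (row_form n f + row_form n (\<lambda>i. f (2^n + i))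
      + 2 * (1 * S / (1 + S) * (t - (l + r) / 2)^2) + 2 * (3 * S / (3 + S) * (0 - (l - r) / 2)^2))"
    unfolding top_form_def trap_mean_Suc row_form.simps S_def[symmetric] l_def[symmetric] r_def[symmetric]
    by (simp only: distrib_left)
  moreover have "(5/3) * ((t - x)^2 + (x - y)^2 + (y - t)^2 + top_form n f x + top_form n (\<lambda>i. f (2^n + i)) y)
    = (5/3) * (row_form n f + row_form n (\<lambda>i. f (2^n + i))
       + ((t - x)^2 + (x - y)^2 + (y - t)^2 + S * (x - l)^2 + S * (y - r)^2))"
    by (simp add: top_form_def S_def l_def r_def)
  ultimately show ?thesis
    unfolding * series_square[OF zero_less_one S] series_square[of 3 S, OF _ S, simplified]
    by (simp add: distrib_left)
qed

lemma top_form_0: "top_form 0 f t = (t - f 0)^2 + (f 0 - f 1)^2 + (f 1 - t)^2"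
  by (simp add: top_form_def trap_mean_def trap_weight_def power2_eq_square field_simps)

lemma row_pt_0: "row_pt q n 0 = q 1"
  and row_pt_end: "row_pt q n (2^n) = q 2"
  by (simp_all add: row_pt_def)

section \<open>Cells and gasket of an equilateral triangle\<close>

context
  fixes q :: "nat \<Rightarrow> real^2"
  assumes equilateral: "equilateral q"
begin

text \<open>With squared side \<open>s\<close>, the vertices taken relative to the centroid have
  inner products \<open>s/3\<close> if equal and \<open>- s/6\<close> if distinct; this explains the
  constants \<open>1/3\<close> and \<open>2 / s\<close> in \<open>bary\<close>.\<close>

lemma bary_vertex:
  assumes "j < 3" "k < 3"
  shows "bary q k (q j) = of_bool (j = k)"
proof -
  define s where "s = (dist (q 0) (q 1))^2"
  have "q 0 \<noteq> q 1" using equilateral by (simp add: equilateral_def)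
  then have "s > 0" by (simp add: s_def)
  have d: "(dist x y)^2 = x \<bullet> x + y \<bullet> y - 2 * (x \<bullet> y)" for x y :: "real^2"
    by (simp add: dist_norm power2_norm_eq_inner inner_simps inner_commute)
  have s: "s = q 0 \<bullet> q 0 + q 1 \<bullet> q 1 - 2 * (q 0 \<bullet> q 1)"
    "s = q 1 \<bullet> q 1 + q 2 \<bullet> q 2 - 2 * (q 1 \<bullet> q 2)"
    "s = q 0 \<bullet> q 0 + q 2 \<bullet> q 2 - 2 * (q 0 \<bullet> q 2)"
    using equilateral unfolding s_def equilateral_def d[symmetric] by (simp_all add: dist_commute)
  have inner: "(q j - (1/3) *\<^sub>R (q 0 + q 1 + q 2)) \<bullet> (q k - (1/3) *\<^sub>R (q 0 + q 1 + q 2))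
      = (of_bool (j = k) - 1/3) * s / 2"
    using assms s inner_commute[of "q 1" "q 0"] inner_commute[of "q 2" "q 0"] inner_commute[of "q 2" "q 1"]
    unfolding less_3_cases by (elim disjE) (simp_all add: inner_simps field_simps)
  show ?thesis
    unfolding bary_def s_def[symmetric] inner using \<open>s > 0\<close> by simp
qed

lemma bary_F: "i < 3 \<Longrightarrow> k < 3 \<Longrightarrow> bary q k (F q i x) = (bary q k x + of_bool (i = k)) / 2"
  unfolding F_def bary_midpoint by (simp add: bary_vertex)

lemma vertex_in_triangle: "j < 3 \<Longrightarrow> q j \<in> big_triangle q"
  by (auto simp: big_triangle_def bary_vertex less_3_cases sum_lessThan_3)

lemma F_in_triangle:
  assumes "i < 3" "x \<in> big_triangle q"
  shows "F q i x \<in> big_triangle q"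
proof -
  have "F q i x = (1/2) *\<^sub>R ((\<Sum>k<3. bary q k x *\<^sub>R q k) + q i)"
    using assms(2) by (simp add: F_def big_triangle_def)
  also have "\<dots> = (\<Sum>k<3. bary q k (F q i x) *\<^sub>R q k)"
    using assms(1) unfolding sum_lessThan_3
    by (auto simp: bary_F less_3_cases algebra_simps add_divide_distrib)
  finally have "F q i x = (\<Sum>k<3. bary q k (F q i x) *\<^sub>R q k)" .
  moreover have "0 \<le> bary q k (F q i x)" if "k < 3" for k
    using assms that by (simp add: big_triangle_def bary_F)
  ultimately show ?thesis
    unfolding big_triangle_def by blast
qed

lemma eq_vertex:
  assumes "x \<in> big_triangle q" "j < 3" "bary q j x \<ge> 1"
  shows "x = q j"
proof -
  have "0 \<le> bary q 0 x" "0 \<le> bary q 1 x" "0 \<le> bary q 2 x"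
    using assms(1) by (simp_all add: big_triangle_def)
  then have bary: "bary q k x = of_bool (j = k)" if "k < 3" for k
    using assms(2,3) that sum_bary[of q x] unfolding less_3_cases by (elim disjE) simp_all
  have "x = (\<Sum>k<3. bary q k x *\<^sub>R q k)"
    using assms(1) by (simp add: big_triangle_def)
  also have "\<dots> = q j"
    using assms(2) unfolding less_3_cases by (elim disjE) (simp_all add: sum_lessThan_3 bary)
  finally show ?thesis .
qed

text \<open>For \<open>i \<noteq> j\<close> the map \<open>F q i\<close> halves the coordinate
  \<open>j\<close>, so reaching \<open>1/2\<close> requires a coordinate of at least
  \<open>1\<close>, which occurs in the triangle only at \<open>q j\<close>. Distinct cells
  therefore meet only at junction points.\<close>

lemma bary_F_ge_half:
  assumes "x \<in> big_triangle q" "i < 3" "j < 3" "bary q j (F q i x) \<ge> 1/2"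
  shows "i = j \<or> x = q j"
  using assms eq_vertex[of x j] by (cases "i = j") (simp_all add: bary_F)

lemma F_eq_F:
  assumes "x \<in> big_triangle q" "y \<in> big_triangle q" "i < 3" "j < 3" "F q i x = F q j y" "i \<noteq> j"
  shows "x = q j"
proof -
  have "bary q j (F q j y) \<ge> 1/2"
    using assms by (auto simp: bary_F big_triangle_def)
  then show ?thesis using bary_F_ge_half[of x i j] assms by simp
qed

lemma compact_triangle: "compact (big_triangle q)"
  unfolding compact_eq_bounded_closed
proof
  show "bounded (big_triangle q)"
  proof (rule boundedI)
    fix x assume x: "x \<in> big_triangle q"
    have "norm x = norm (\<Sum>k<3. bary q k x *\<^sub>R q k)"
      using x by (simp add: big_triangle_def)
    also have "\<dots> \<le> (\<Sum>k<3. norm (q k))"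
    proof (rule sum_norm_le)
      fix k :: nat assume k: "k \<in> {..<3}"
      then have "\<bar>bary q k x\<bar> \<le> 1"
        using x bary_le_1[OF x] by (auto simp: big_triangle_def)
      then show "norm (bary q k x *\<^sub>R q k) \<le> norm (q k)"
        by (simp add: mult_left_le_one_le)
    qed
    finally show "norm x \<le> (\<Sum>k<3. norm (q k))" .
  qed
  show "closed (big_triangle q)"
    unfolding big_triangle_def
    by (auto intro!: closed_Collect_conj closed_Collect_all closed_Collect_imp open_Collect_const
        closed_Collect_le closed_Collect_eq continuous_intros)
qed

lemma SG_properties:
  shows compact_SG: "compact (SG q)"
    and SG_fixed: "SG q = (\<Union>i<3. F q i ` SG q)"
    and SG_subset_triangle: "SG q \<subseteq> big_triangle q"
    and vertex_in_SG: "j < 3 \<Longrightarrow> q j \<in> SG q"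
proof -
  \<comment> \<open>The gasket is the closure of the union of all vertex sets: existence is checked
    for this set, uniqueness is \<open>attractor_subset\<close> used twice.\<close>
  define W where "W = (\<Union>m. V q m)"
  have "V q m \<subseteq> big_triangle q" for m
    by (induction m) (auto simp: vertex_in_triangle F_in_triangle subset_iff)
  then have sub: "closure W \<subseteq> big_triangle q"
    unfolding W_def using compact_triangle by (intro closure_minimal compact_imp_closed) auto
  have cpt: "compact (closure W)"
    using sub compact_triangle by (meson closed_closure compact_Int_closed compact_eq_bounded_closed bounded_subset)
  have v: "q ` {..<3} \<subseteq> W" unfolding W_def using V.simps(1) by blast
  have W: "W = (\<Union>i<3. F q i ` W)"
  proof
    show "(\<Union>i<3. F q i ` W) \<subseteq> W"
    proof
      fix x assume "x \<in> (\<Union>i<3. F q i ` W)"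
      then obtain i y m where "i < 3" "x = F q i y" "y \<in> V q m" by (auto simp: W_def)
      then have "x \<in> V q (Suc m)" by auto
      then show "x \<in> W" unfolding W_def by blast
    qed
    have "V q m \<subseteq> (\<Union>i<3. F q i ` W)" for m
    proof (cases m)
      case 0
      \<comment> \<open>At level zero a vertex lies in its own cell as the fixed point of the
        corresponding map.\<close>
      have "q i = F q i (q i)" "q i \<in> W" if "i < 3" for i
        using v that by (auto simp: F_vertex)
      then show ?thesis unfolding 0 by fastforce
    next
      case (Suc k)
      then show ?thesis by (auto simp: W_def)
    qed
    then show "W \<subseteq> (\<Union>i<3. F q i ` W)" by (auto simp: W_def)
  qed
  have "closure W = closure (\<Union>i<3. F q i ` W)"
    by (rule arg_cong[OF W])
  also have "\<dots> = (\<Union>i<3. F q i ` closure W)"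
    by (simp add: F_image_closure eval_nat_numeral lessThan_Suc)
  finally have fix_cl: "closure W = (\<Union>i<3. F q i ` closure W)" .
  have "q 0 \<in> W" using v by (auto simp: image_subset_iff)
  then have ne: "closure W \<noteq> {}" by auto
  have SG: "SG q = closure W"
    unfolding SG_def
  proof (rule the_equality)
    show "compact (closure W) \<and> closure W \<noteq> {} \<and> closure W = (\<Union>i<3. F q i ` closure W)"
      using cpt ne fix_cl by blast
    fix K assume "compact K \<and> K \<noteq> {} \<and> K = (\<Union>i<3. F q i ` K)"
    then show "K = closure W"
      using attractor_subset[of K q "closure W"] attractor_subset[of "closure W" q K] cpt ne fix_cl by blast
  qed
  show "compact (SG q)" "SG q \<subseteq> big_triangle q" "SG q = (\<Union>i<3. F q i ` SG q)"
    unfolding SG using cpt ne sub fix_cl by blast+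
  show "q j \<in> SG q" if "j < 3"
    unfolding SG using v that closure_subset by blast
qed

lemma F_in_SG: "i < 3 \<Longrightarrow> x \<in> SG q \<Longrightarrow> F q i x \<in> SG q"
  using SG_fixed by blast

lemma in_triangle: "x \<in> SG q \<Longrightarrow> x \<in> big_triangle q"
  using SG_subset_triangle by blast

lemma SG_cases:
  assumes "x \<in> SG q"
  obtains i y where "i < 3" "y \<in> SG q" "x = F q i y"
  using assms SG_fixed by blast

section \<open>Self-similarity and monotonicity of the graph energies\<close>

lemma Fw_vertex_in_SG:
  "w \<in> words m \<Longrightarrow> x \<in> Fw q w ` V q 0 \<Longrightarrow> x \<in> SG q"
proof (induction m arbitrary: w x)
  case (Suc m)
  then show ?case
    by (auto simp: words_Suc Fw_def intro!: F_in_SG)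
qed (auto simp: words_0 Fw_def vertex_in_SG)

lemma edges_SG: "(x, y) \<in> edges q m \<Longrightarrow> x \<in> SG q \<and> y \<in> SG q \<and> x \<noteq> y"
  unfolding edges_def adj_def using Fw_vertex_in_SG by blast

lemma graph_energy_cong:
  "(\<And>x. x \<in> SG q \<Longrightarrow> u x = v x) \<Longrightarrow> graph_energy q m u = graph_energy q m v"
  unfolding graph_energy_edges using edges_SG
  by (intro arg_cong[where f="\<lambda>s. (5/3)^m * (1/2 * s)"] sum.cong) auto

lemma inj_vertex: "inj_on q {..<3}"
proof (rule inj_onI)
  fix i j assume ij: "i \<in> {..<3::nat}" "j \<in> {..<3::nat}" and eq: "q i = q j"
  have "of_bool (i = i) = (of_bool (j = i) :: real)"
    using bary_vertex[of i i] bary_vertex[of j i] ij eq by (metis lessThan_iff)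
  then show "i = j"
    by (cases "j = i") simp_all
qed

lemma graph_energy_0: "graph_energy q 0 u = tri_energy (\<lambda>i. u (q i))"
proof -
  have ne: "q 0 \<noteq> q 1" "q 1 \<noteq> q 2" "q 0 \<noteq> q 2"
    using inj_vertex by (auto dest: inj_onD)
  have "edges q 0 = {(q 0, q 1), (q 1, q 0), (q 1, q 2), (q 2, q 1), (q 2, q 0), (q 0, q 2)}"
    using ne by (auto simp: edges_def adj_def words_0 Fw_def less_3_cases)
  then show ?thesis
    unfolding graph_energy_edges tri_energy_def using ne
    by (simp add: ne[symmetric] power2_commute)
qed

text \<open>The edges of the next level split into those of the three cells. The splitting is
  disjoint because two cells share at most one point, whereas an edge has two distinct
  endpoints.\<close>

lemma graph_energy_Suc:
  "graph_energy q (Suc m) u = (5/3) * (\<Sum>i<3. graph_energy q m (\<lambda>x. u (F q i x)))"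
proof -
  have disj: "map_prod (F q i) (F q i) ` edges q m \<inter> map_prod (F q j) (F q j) ` edges q m = {}"
    if "i < 3" "j < 3" "i \<noteq> j" for i j
  proof -
    have False if "(x, y) \<in> edges q m" "(x', y') \<in> edges q m" "F q i x = F q j x'" "F q i y = F q j y'"
      for x y x' y'
      using F_eq_F[of x x' i j] F_eq_F[of y y' i j] that
        \<open>i < 3\<close> \<open>j < 3\<close> \<open>i \<noteq> j\<close> edges_SG[of x y] edges_SG[of x' y'] in_triangle by metis
    then show ?thesis by auto
  qed
  have "(\<Sum>(x,y)\<in>edges q (Suc m). (u x - u y)^2)
      = (\<Sum>i<3. \<Sum>(x,y)\<in>map_prod (F q i) (F q i) ` edges q m. (u x - u y)^2)"
    unfolding edges_Suc by (rule sum.UNION_disjoint) (auto simp: finite_edges disj)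
  also have "\<dots> = (\<Sum>i<3. \<Sum>(x,y)\<in>edges q m. (u (F q i x) - u (F q i y))^2)"
  proof (rule sum.cong)
    fix i
    have "inj_on (map_prod (F q i) (F q i)) (edges q m)"
      by (rule inj_on_subset[OF prod.inj_map[OF inj_F inj_F]]) simp
    then show "(\<Sum>(x,y)\<in>map_prod (F q i) (F q i) ` edges q m. (u x - u y)^2)
        = (\<Sum>(x,y)\<in>edges q m. (u (F q i x) - u (F q i y))^2)"
      by (simp add: sum.reindex case_prod_unfold)
  qed simp
  finally show ?thesis
    unfolding graph_energy_edges power_Suc by (simp only: sum_distrib_left mult.assoc mult.left_commute)
qed

text \<open>Self-similarity reduces the claim to the first refinement, which is
  \<open>tri_energy_le\<close> for the values \<open>u (F q i (q j))\<close>.\<close>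

lemma graph_energy_mono: "graph_energy q m u \<le> graph_energy q (Suc m) u"
proof (induction m arbitrary: u)
  case 0
  show ?case
    unfolding graph_energy_Suc graph_energy_0
    by (rule tri_energy_le) (simp_all add: F_vertex, metis F_vertex_commute)
next
  case (Suc m)
  show ?case
    unfolding graph_energy_Suc[of "Suc m"] graph_energy_Suc[of m u]
    using Suc.IH by (intro mult_left_mono sum_mono) auto
qed

lemma incseq_graph_energy: "incseq (\<lambda>m. graph_energy q m u)"
  using graph_energy_mono by (rule incseq_SucI)

lemma energy_ge_graph_energy: "ereal (graph_energy q n u) \<le> energy q u"
proof -
  have inc: "incseq (\<lambda>m. ereal (graph_energy q m u))"
    using incseq_graph_energy by (simp add: incseq_def)
  have "energy q u = (SUP m. ereal (graph_energy q m u))"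
    unfolding energy_def by (intro limI LIMSEQ_SUP inc)
  then show ?thesis by (metis SUP_upper UNIV_I)
qed

section \<open>Gluing along cells and harmonic functions\<close>

lemma glue_F:
  assumes "compatible q us" "i < 3" "x \<in> SG q"
  shows "glue q us (F q i x) = us i x"
proof -
  note x = in_triangle[OF assms(3)]
  define j where "j = (LEAST j. j = 2 \<or> bary q j (F q i x) \<ge> 1/2)"
  have i: "bary q i (F q i x) \<ge> 1/2"
    using x assms(2) by (simp add: bary_F big_triangle_def)
  \<comment> \<open>The alternative \<open>j = 2\<close> only guarantees that the least index
    exists. As \<open>j \<le> i\<close>, the case \<open>j = 2\<close> forces \<open>i = 2\<close>,
    so coordinate \<open>j\<close> is at least \<open>1/2\<close> anyway;
    \<open>j \<noteq> i\<close> is then possible only at a junction.\<close>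
  have "j = 2 \<or> bary q j (F q i x) \<ge> 1/2"
    unfolding j_def by (rule LeastI[of _ 2]) simp
  moreover have "j \<le> i" unfolding j_def by (rule Least_le) (use i in simp)
  ultimately have j: "j < 3" "bary q j (F q i x) \<ge> 1/2"
    using assms(2) i by (auto simp: less_3_cases)
  have glue: "glue q us (F q i x) = us j (2 *\<^sub>R F q i x - q j)"
    unfolding glue_def Let_def j_def ..
  show ?thesis
  proof (cases "i = j")
    case True
    then show ?thesis unfolding glue by (simp add: F_def)
  next
    case False
    then have "x = q j" using bary_F_ge_half[OF x assms(2) j] by simp
    then show ?thesis using assms j unfolding glue by (simp add: F_def compatible_def)
  qed
qed

lemma glue_vertex: "compatible q us \<Longrightarrow> i < 3 \<Longrightarrow> glue q us (q i) = us i (q i)"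
  using glue_F[of us i "q i"] vertex_in_SG by (simp add: F_vertex)

lemma continuous_on_glue:
  assumes us: "compatible q us" "\<And>i. i < 3 \<Longrightarrow> continuous_on (SG q) (us i)"
  shows "continuous_on (SG q) (glue q us)"
proof -
  have "continuous_on (F q i ` SG q) (glue q us)" if "i < 3" for i
  proof -
    have "continuous_on (F q i ` SG q) (\<lambda>x. us i (2 *\<^sub>R x - q i))"
      by (rule continuous_on_compose2[OF us(2)[OF that]]) (auto simp: F_def intro!: continuous_intros)
    then show ?thesis
      by (rule continuous_on_eq) (auto simp: glue_F[OF us(1) that], simp add: F_def)
  qed
  moreover have "closed (F q i ` SG q)" for i
    by (intro compact_imp_closed compact_continuous_image continuous_on_F compact_SG equilateral)
  ultimately have "continuous_on (\<Union>i\<in>{..<3}. F q i ` SG q) (glue q us)"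
    by (intro continuous_on_closed_Union) auto
  then show ?thesis unfolding SG_fixed[symmetric] .
qed

lemma compatible_harmonic_approx:
  assumes "\<And>h i. i < 3 \<Longrightarrow> harmonic_approx q k h (q i) = h i"
  shows "compatible q (\<lambda>i. harmonic_approx q k (cell_bdry h i))"
  using assms cell_bdry_commute by (simp add: compatible_def)

lemma harmonic_approx_vertex: "i < 3 \<Longrightarrow> harmonic_approx q k h (q i) = h i"
proof (induction k arbitrary: h i)
  case 0
  then show ?case
    by (auto simp: sum_lessThan_3 less_3_cases bary_vertex)
next
  case (Suc k)
  then show ?case
    using glue_vertex[OF compatible_harmonic_approx[of k h] Suc.prems] by (simp add: cell_bdry_def)
qed

lemma harmonic_approx_F:
  "i < 3 \<Longrightarrow> x \<in> SG q \<Longrightarrow> harmonic_approx q (Suc k) h (F q i x) = harmonic_approx q k (cell_bdry h i) x"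
  using glue_F[OF compatible_harmonic_approx[OF harmonic_approx_vertex]] by simp

lemma continuous_on_harmonic_approx: "continuous_on (SG q) (harmonic_approx q k h)"
proof (induction k arbitrary: h)
  case 0
  show ?case by (simp, intro continuous_intros)
next
  case (Suc k)
  then show ?case
    using continuous_on_glue[OF compatible_harmonic_approx[OF harmonic_approx_vertex]] by simp
qed

lemma harmonic_approx_0_near:
  assumes "x \<in> SG q" "\<And>i j. i < 3 \<Longrightarrow> j < 3 \<Longrightarrow> \<bar>h i - h j\<bar> \<le> D" "l < 3"
  shows "\<bar>harmonic_approx q 0 h x - h l\<bar> \<le> D"
proof -
  have b: "0 \<le> bary q j x" if "j < 3" for j
    using in_triangle[OF assms(1)] that by (simp add: big_triangle_def)
  have sum1: "(\<Sum>j<3. bary q j x) = 1" using sum_bary[of q x] by (simp add: sum_lessThan_3)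
  have "harmonic_approx q 0 h x - h l = (\<Sum>j<3. bary q j x * (h j - h l))"
    by (simp add: right_diff_distrib sum_subtractf sum1 flip: sum_distrib_right)
  also have "\<bar>\<dots>\<bar> \<le> (\<Sum>j<3. bary q j x * D)"
    by (rule order_trans[OF sum_abs], rule sum_mono) (auto simp: abs_mult b intro!: mult_left_mono assms)
  finally show ?thesis by (simp add: sum1 flip: sum_distrib_right)
qed

text \<open>Passing to a cell lowers \<open>k\<close> by one and shrinks the oscillation by
  \<open>3/5\<close>. In the base case both approximations are close to the same corner value
  \<open>h i\<close>, within \<open>(3/5) * D\<close> and \<open>D\<close>.\<close>

lemma harmonic_approx_diff:
  assumes "x \<in> SG q" "\<And>i j. i < 3 \<Longrightarrow> j < 3 \<Longrightarrow> \<bar>h i - h j\<bar> \<le> D"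
  shows "\<bar>harmonic_approx q (Suc k) h x - harmonic_approx q k h x\<bar> \<le> 2 * D * (3/5)^k"
  using assms
proof (induction k arbitrary: x h D)
  case 0
  obtain i y where i: "i < 3" "y \<in> SG q" "x = F q i y"
    using SG_cases[OF 0(1)] by blast
  have "\<bar>harmonic_approx q 0 (cell_bdry h i) y - cell_bdry h i i\<bar> \<le> (3/5) * D"
    using i 0 by (intro harmonic_approx_0_near cell_bdry_osc)
  moreover have "\<bar>harmonic_approx q 0 h x - h i\<bar> \<le> D"
    using i 0 by (intro harmonic_approx_0_near)
  moreover have "D \<ge> 0" using 0(2)[of 0 0] by simp
  ultimately show ?case
    using cell_bdry_self[of h i] unfolding i(3) harmonic_approx_F[OF i(1,2)] power_0 by linarith
next
  case (Suc k)
  obtain i y where i: "i < 3" "y \<in> SG q" "x = F q i y"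
    using SG_cases[OF Suc.prems(1)] by blast
  have "\<bar>harmonic_approx q (Suc k) (cell_bdry h i) y - harmonic_approx q k (cell_bdry h i) y\<bar>
      \<le> 2 * ((3/5) * D) * (3/5)^k"
    using i Suc.prems(2) by (intro Suc.IH cell_bdry_osc)
  then show ?case
    unfolding i(3) harmonic_approx_F[OF i(1,2)] by (simp add: mult_ac del: harmonic_approx.simps)
qed

lemma harmonic_approx_limit:
  obtains H where "continuous_on (SG q) H" "\<And>x. x \<in> SG q \<Longrightarrow> (\<lambda>k. harmonic_approx q k h x) \<longlonglongrightarrow> H x"
proof -
  define D where "D = \<bar>h 0 - h 1\<bar> + \<bar>h 1 - h 2\<bar> + \<bar>h 0 - h 2\<bar>"
  let ?d = "\<lambda>k x. harmonic_approx q (Suc k) h x - harmonic_approx q k h x"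
  have D: "\<bar>h i - h j\<bar> \<le> D" if "i < 3" "j < 3" for i j
    using that unfolding D_def less_3_cases by auto
  have telescope: "(\<Sum>k<n. ?d k x) = harmonic_approx q n h x - harmonic_approx q 0 h x" for n x
    by (rule sum_lessThan_telescope)
  have "uniform_limit (SG q) (\<lambda>n x. \<Sum>k<n. ?d k x) (\<lambda>x. suminf (\<lambda>k. ?d k x)) sequentially"
  proof (rule Weierstrass_m_test)
    show "norm (?d k x) \<le> 2 * D * (3/5)^k" if "x \<in> SG q" for k x
      using harmonic_approx_diff[OF that D] by simp
    show "summable (\<lambda>k. 2 * D * (3/5)^k)"
      by (intro summable_mult summable_geometric) simp
  qed
  then have lim: "uniform_limit (SG q) (\<lambda>n x. harmonic_approx q n h x - harmonic_approx q 0 h x)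
      (\<lambda>x. suminf (\<lambda>k. ?d k x)) sequentially"
    unfolding telescope .
  show thesis
  proof
    have "continuous_on (SG q) (\<lambda>x. suminf (\<lambda>k. ?d k x))"
      by (rule uniform_limit_theorem[OF _ lim])
         (simp_all add: continuous_on_diff continuous_on_harmonic_approx del: harmonic_approx.simps)
    then show "continuous_on (SG q) (\<lambda>x. harmonic_approx q 0 h x + suminf (\<lambda>k. ?d k x))"
      by (intro continuous_intros continuous_on_harmonic_approx)
    fix x assume "x \<in> SG q"
    from tendsto_add[OF tendsto_const tendsto_uniform_limitI[OF lim this], of "harmonic_approx q 0 h x"]
    show "(\<lambda>k. harmonic_approx q k h x) \<longlonglongrightarrow> harmonic_approx q 0 h x + suminf (\<lambda>k. ?d k x)"
      by (simp del: harmonic_approx.simps)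
  qed
qed

text \<open>The limits are chosen for all boundary values at once, since restricting
  \<open>H h\<close> to a cell gives \<open>H (cell_bdry h i)\<close>. Because the harmonic rule
  conserves \<open>tri_energy\<close>, the graph energy is the same at every level.\<close>

lemma harmonic_exists:
  obtains u where "continuous_on (SG q) u" "\<And>i. i < 3 \<Longrightarrow> u (q i) = h i"
    "\<And>m. graph_energy q m u = tri_energy h"
proof -
  have "\<exists>H. continuous_on (SG q) H \<and> (\<forall>x\<in>SG q. (\<lambda>k. harmonic_approx q k h x) \<longlonglongrightarrow> H x)" for h
    by (rule harmonic_approx_limit[of h]) blast
  then have "\<exists>H. \<forall>h. continuous_on (SG q) (H h) \<and> (\<forall>x\<in>SG q. (\<lambda>k. harmonic_approx q k h x) \<longlonglongrightarrow> H h x)"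
    by (intro choice) blast
  then obtain H where H: "\<And>h. continuous_on (SG q) (H h)"
    "\<And>h x. x \<in> SG q \<Longrightarrow> (\<lambda>k. harmonic_approx q k h x) \<longlonglongrightarrow> H h x"
    by blast
  have vertex: "H h (q i) = h i" if "i < 3" for h i
  proof -
    have "(\<lambda>k. harmonic_approx q k h (q i)) \<longlonglongrightarrow> H h (q i)"
      using H vertex_in_SG[OF that] by blast
    then show ?thesis
      unfolding harmonic_approx_vertex[OF that] LIMSEQ_const_iff by (rule sym)
  qed
  have F: "H h (F q i x) = H (cell_bdry h i) x" if "i < 3" "x \<in> SG q" for h i x
  proof (rule LIMSEQ_unique)
    show "(\<lambda>k. harmonic_approx q (Suc k) h (F q i x)) \<longlonglongrightarrow> H h (F q i x)"
      using H F_in_SG[OF that] by (intro LIMSEQ_Suc) blast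
    show "(\<lambda>k. harmonic_approx q (Suc k) h (F q i x)) \<longlonglongrightarrow> H (cell_bdry h i) x"
      unfolding harmonic_approx_F[OF that] using H that(2) by blast
  qed
  have "graph_energy q m (H h) = tri_energy h" for m h
  proof (induction m arbitrary: h)
    case 0
    show ?case unfolding graph_energy_0 by (simp add: tri_energy_def vertex)
  next
    case (Suc m)
    have "graph_energy q m (\<lambda>x. H h (F q i x)) = tri_energy (cell_bdry h i)" if "i < 3" for i
      using Suc.IH[of "cell_bdry h i"] graph_energy_cong[OF F[OF that]] by simp
    then have "(\<Sum>i<3. graph_energy q m (\<lambda>x. H h (F q i x))) = (\<Sum>i<3. tri_energy (cell_bdry h i))"
      by (intro sum.cong) simp_all
    then show ?case
      unfolding graph_energy_Suc by (simp only: tri_energy_cell_bdry)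
  qed
  then show thesis using that H vertex by blast
qed

section \<open>Least energy for prescribed values on the row and at the top\<close>

lemma row_pt_in_SG: "i \<le> 2^n \<Longrightarrow> row_pt q n i \<in> SG q"
proof (induction n arbitrary: i)
  case 0
  then have "i = 0 \<or> i = 1" by auto
  then show ?case
    using vertex_in_SG row_pt_0[of q 0] row_pt_end[of q 0] by auto
next
  case (Suc n)
  from Suc.prems show ?case
  proof (cases rule: row_index_cases)
    case 1
    then show ?thesis unfolding row_pt_Suc(1) by (intro F_in_SG Suc.IH) auto
  next
    case (2 j)
    then show ?thesis unfolding 2(2) row_pt_Suc(2) by (intro F_in_SG Suc.IH) auto
  qed
qed

lemma inj_row_pt: "inj (row_pt q n)"
proof (rule injI)
  fix i j assume "row_pt q n i = row_pt q n j"
  moreover have "q 2 - q 1 \<noteq> 0"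
    using equilateral by (auto simp: equilateral_def)
  ultimately show "i = j" by (simp add: row_pt_def)
qed

text \<open>The coordinate \<open>bary q 0\<close> is affine along the row and vanishes at both of
  its ends, but equals \<open>1\<close> at \<open>q 0\<close>.\<close>

lemma top_notin_row: "q 0 \<noteq> row_pt q n i"
proof
  assume "q 0 = row_pt q n i"
  then have "bary q 0 (q 0) = bary q 0 (q 1 + (real i / 2^n) *\<^sub>R (q 2 - q 1))"
    by (simp add: row_pt_def)
  also have "\<dots> = bary q 0 (q 1) + (real i / 2^n) * (bary q 0 (q 2) - bary q 0 (q 1))"
    unfolding bary_def by (simp add: inner_simps algebra_simps)
  finally show False by (simp add: bary_vertex)
qed

text \<open>The top cell contributes at least its triangle energy and the lower cells at least their
  forms, by induction; the bound follows on dropping the two nonnegative squares in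
  \<open>top_form_Suc\<close>.\<close>

lemma graph_energy_ge_top_form: "top_form n (\<lambda>i. v (row_pt q n i)) (v (q 0)) \<le> graph_energy q n v"
proof (induction n arbitrary: v)
  case 0
  show ?case
    unfolding graph_energy_0 top_form_0
    using row_pt_0[of q 0] row_pt_end[of q 0] by (simp add: tri_energy_def)
next
  case (Suc n)
  let ?x = "v (F q 0 (q 1))" and ?y = "v (F q 0 (q 2))" and ?f = "\<lambda>i. v (row_pt q (Suc n) i)"
  have "tri_energy (\<lambda>i. v (F q 0 (q i))) \<le> graph_energy q n (\<lambda>x. v (F q 0 x))"
    using incseqD[OF incseq_graph_energy[of "\<lambda>x. v (F q 0 x)"], of 0 n] unfolding graph_energy_0 by simp
  then have 0: "(v (q 0) - ?x)^2 + (?x - ?y)^2 + (?y - v (q 0))^2 \<le> graph_energy q n (\<lambda>x. v (F q 0 x))"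
    by (simp add: tri_energy_def F_vertex)
  have 1: "top_form n ?f ?x \<le> graph_energy q n (\<lambda>x. v (F q 1 x))"
    using Suc.IH[of "\<lambda>x. v (F q 1 x)"] unfolding row_pt_Suc(1) F_vertex_commute[of q 1 0] .
  have 2: "top_form n (\<lambda>i. ?f (2^n + i)) ?y \<le> graph_energy q n (\<lambda>x. v (F q 2 x))"
    using Suc.IH[of "\<lambda>x. v (F q 2 x)"] unfolding row_pt_Suc(2) F_vertex_commute[of q 2 0] .
  have "top_form (Suc n) ?f (v (q 0))
      \<le> (5/3) * ((v (q 0) - ?x)^2 + (?x - ?y)^2 + (?y - v (q 0))^2 + top_form n ?f ?x + top_form n (\<lambda>i. ?f (2^n + i)) ?y)"
    unfolding top_form_Suc[where f="?f"] using top_cond_pos[of n] by simp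
  also have "\<dots> \<le> graph_energy q (Suc n) v"
    unfolding graph_energy_Suc sum_lessThan_3 using 0 1 2 by simp
  finally show ?case .
qed

text \<open>A harmonic function on the top cell is glued to inductively obtained extensions on the
  lower cells. The graph energy is constant only from some level on, since coarse graphs do not see
  the whole row.\<close>

lemma top_form_extension:
  obtains u N where "continuous_on (SG q) u" "u (q 0) = t" "\<And>i. i \<le> 2^n \<Longrightarrow> u (row_pt q n i) = f i"
    "\<And>m. m \<ge> N \<Longrightarrow> graph_energy q m u = top_form n f t"
proof -
  have "\<exists>u N. continuous_on (SG q) u \<and> u (q 0) = t \<and> (\<forall>i\<le>2^n. u (row_pt q n i) = f i) \<and>
      (\<forall>m\<ge>N. graph_energy q m u = top_form n f t)"
  proof (induction n arbitrary: f t)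
    case 0
    \<comment> \<open>The row indices \<open>0\<close> and \<open>1\<close> sit at the vertices
      \<open>q 1\<close> and \<open>q 2\<close>, whence the shift \<open>i - 1\<close>.\<close>
    obtain u where u: "continuous_on (SG q) u"
      "\<And>i. i < 3 \<Longrightarrow> u (q i) = (if i = 0 then t else f (i - 1))"
      "\<And>m. graph_energy q m u = tri_energy (\<lambda>i. if i = 0 then t else f (i - 1))"
      using harmonic_exists[of "\<lambda>i. if i = 0 then t else f (i - 1)"] by auto
    have "u (row_pt q 0 i) = f i" if "i \<le> 1" for i
    proof -
      have "i = 0 \<or> i = 1" using that by auto
      then show ?thesis using u(2)[of 1] u(2)[of 2] row_pt_0[of q 0] row_pt_end[of q 0] by auto
    qed
    moreover have "u (q 0) = t" using u(2)[of 0] by simp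
    moreover have "graph_energy q m u = top_form 0 f t" for m
      using u(3) by (simp add: top_form_0 tri_energy_def)
    ultimately show ?case using u(1) by auto
  next
    case (Suc n)
    let ?g = "\<lambda>i. f (2^n + i)"
    let ?S = "top_cond n" and ?l = "trap_mean n f" and ?r = "trap_mean n ?g"
    \<comment> \<open>\<open>s\<close> and \<open>d\<close> are the half sum and half difference of
      the corner values at which both squares in \<open>top_form_Suc\<close> vanish.\<close>
    define s where "s = (t + ?S * ((?l + ?r) / 2)) / (1 + ?S)"
    define d where "d = ?S * ((?l - ?r) / 2) / (3 + ?S)"
    define x y where "x = s + d" and "y = s - d"
    obtain v M where v: "continuous_on (SG q) v" "v (q 0) = x" "\<And>i. i \<le> 2^n \<Longrightarrow> v (row_pt q n i) = f i"
      "\<And>m. m \<ge> M \<Longrightarrow> graph_energy q m v = top_form n f x"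
      using Suc.IH by metis
    obtain w L where w: "continuous_on (SG q) w" "w (q 0) = y" "\<And>i. i \<le> 2^n \<Longrightarrow> w (row_pt q n i) = ?g i"
      "\<And>m. m \<ge> L \<Longrightarrow> graph_energy q m w = top_form n ?g y"
      using Suc.IH by metis
    define h where "h i = (if i = 0 then t else if i = 1 then x else y)" for i :: nat
    obtain u where u: "continuous_on (SG q) u" "\<And>i. i < 3 \<Longrightarrow> u (q i) = h i"
      "\<And>m. graph_energy q m u = tri_energy h"
      using harmonic_exists[of h] by auto
    define us where "us i = (if i = 0 then u else if i = 1 then v else w)" for i :: nat
    have us: "us 0 = u" "us 1 = v" "us 2 = w" by (simp_all add: us_def)
    \<comment> \<open>The lower pieces share the row midpoint: the last value on the left is the
      first value on the right.\<close>
    have "v (q 2) = w (q 1)"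
      using v(3)[of "2^n"] w(3)[of 0] row_pt_0[of q n] row_pt_end[of q n] by simp
    then have comp: "compatible q us"
      unfolding compatible_def less_3_cases using u(2)[of 1] u(2)[of 2] v(2) w(2)
      by (auto simp: us_def h_def)
    have "graph_energy q (Suc m) (glue q us) = top_form (Suc n) f t" if "m \<ge> max M L" for m
    proof -
      have "graph_energy q m (\<lambda>x. glue q us (F q i x)) = graph_energy q m (us i)" if "i < 3" for i
        by (rule graph_energy_cong) (rule glue_F[OF comp that])
      then have "graph_energy q (Suc m) (glue q us)
          = (5/3) * (graph_energy q m (us 0) + graph_energy q m (us 1) + graph_energy q m (us 2))"
        unfolding graph_energy_Suc sum_lessThan_3 by simp
      also have "\<dots> = (5/3) * ((t - x)^2 + (x - y)^2 + (y - t)^2 + top_form n f x + top_form n ?g y)"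
        using that unfolding us by (simp add: u(3) v(4) w(4) tri_energy_def h_def)
      also have "\<dots> = top_form (Suc n) f t"
        unfolding top_form_Suc s_def[symmetric] d_def[symmetric] by (simp add: x_def y_def)
      finally show ?thesis .
    qed
    then have "\<forall>m\<ge>Suc (max M L). graph_energy q m (glue q us) = top_form (Suc n) f t"
      by (metis Suc_le_D Suc_le_mono)
    moreover have "continuous_on (SG q) (glue q us)"
      using u(1) v(1) w(1) by (intro continuous_on_glue[OF comp]) (simp add: us_def)
    moreover have "glue q us (q 0) = t"
      using glue_vertex[OF comp, of 0] u(2)[of 0] by (simp add: us_def h_def)
    moreover have "glue q us (row_pt q (Suc n) i) = f i" if "i \<le> 2^Suc n" for i
      using that
    proof (cases rule: row_index_cases)
      case 1
      then show ?thesis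
        using glue_F[OF comp, of 1 "row_pt q n i"] row_pt_in_SG[OF 1] v(3)
        by (simp add: row_pt_Suc(1) us_def)
    next
      case (2 j)
      then show ?thesis
        using glue_F[OF comp, of 2 "row_pt q n j"] row_pt_in_SG[OF 2(1)] w(3)
        by (simp add: row_pt_Suc(2) us_def)
    qed
    ultimately show ?case by blast
  qed
  then show thesis using that by blast
qed

lemma top_form_minimizer:
  obtains u where "u \<in> dom_energy q" "u (q 0) = t" "\<And>i. i \<le> 2^n \<Longrightarrow> u (row_pt q n i) = f i"
    "energy q u = ereal (top_form n f t)"
proof -
  obtain u N where u: "continuous_on (SG q) u" "u (q 0) = t" "\<And>i. i \<le> 2^n \<Longrightarrow> u (row_pt q n i) = f i"
    "\<And>m. m \<ge> N \<Longrightarrow> graph_energy q m u = top_form n f t"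
    using top_form_extension by blast
  from u(4) have "energy q u = ereal (top_form n f t)" by (rule energy_eventually_const)
  with u show thesis by (intro that) (auto simp: dom_energy_def)
qed

lemma energy_ge_top_form: "ereal (top_form n (\<lambda>i. v (row_pt q n i)) (v (q 0))) \<le> energy q v"
  using energy_ge_graph_energy[of n v] graph_energy_ge_top_form[of n v]
  by (meson ereal_less_eq(3) order_trans)

section \<open>Conductances with and without the top vertex\<close>

lemma c_tilde_eq:
  assumes "i \<le> 2^n" "j \<le> 2^n" "i \<noteq> j"
  shows "c_tilde q n i j = row_cond n i j"
proof -
  have row: "bottom_row q n = row_pt q n ` {..2^n}"
    by (simp add: bottom_row_def atMost_atLeast0)
  show ?thesis
    unfolding c_tilde_def row
  proof (rule conductance_eqI)
    show "inj_on (row_pt q n) {..2^n}" by (rule inj_on_subset[OF inj_row_pt]) simp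
    fix f :: "nat \<Rightarrow> real"
    \<comment> \<open>With the value at the top free, the trapezoidal mean is optimal there, as it
      removes the last square of \<open>top_form\<close>.\<close>
    obtain u where "u \<in> dom_energy q" "\<And>i. i \<le> 2^n \<Longrightarrow> u (row_pt q n i) = f i"
      "energy q u = ereal (top_form n f (trap_mean n f))"
      using top_form_minimizer by blast
    then show "\<exists>u. u \<in> dom_energy q \<and> (\<forall>i\<in>{..2^n}. u (row_pt q n i) = f i) \<and>
        energy q u = ereal ((1/2) * (\<Sum>i\<le>2^n. \<Sum>j\<le>2^n. row_cond n i j * (f i - f j)^2))"
      unfolding row_form_eq[symmetric] by (intro exI[of _ u]) (simp add: top_form_def)
  next
    fix v
    have "row_form n (\<lambda>i. v (row_pt q n i)) \<le> top_form n (\<lambda>i. v (row_pt q n i)) (v (q 0))"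
      using top_cond_pos[of n] by (simp add: top_form_def)
    then show "ereal ((1/2) * (\<Sum>i\<le>2^n. \<Sum>j\<le>2^n. row_cond n i j * (v (row_pt q n i) - v (row_pt q n j))^2)) \<le> energy q v"
      using energy_ge_top_form[of n v] unfolding row_form_eq[symmetric]
      by (meson ereal_less_eq(3) order_trans)
  qed (use assms row_cond_sym in auto)
qed

text \<open>The index \<open>2^n + 1\<close> stands for \<open>q 0\<close>. The functional with
  coefficients \<open>m\<close> is the value at the top minus the row mean; it kills constants, so
  \<open>square_zero_sum\<close> converts its square into conductances.\<close>

lemma conductance_with_top:
  assumes "i \<le> 2^n + 1" "j \<le> 2^n + 1" "i \<noteq> j"
  defines "g \<equiv> \<lambda>i. if i \<le> 2^n then row_pt q n i else q 0"
    and "m \<equiv> \<lambda>i. if i \<le> 2^n then - trap_weight n i else 1"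
  shows "conductance q (bottom_row q n \<union> {q 0}) (g i) (g j)
    = (if i \<le> 2^n \<and> j \<le> 2^n then row_cond n i j else 0) - top_cond n * (m i * m j)"
proof -
  let ?I = "{..Suc (2^n)}"
  define C where "C i j = (if i \<le> 2^n \<and> j \<le> 2^n then row_cond n i j else 0) - top_cond n * (m i * m j)" for i j
  have sum_I: "sum h ?I = (\<Sum>i\<le>2^n. h i) + h (Suc (2^n))" for h :: "nat \<Rightarrow> real"
    by simp
  have set: "bottom_row q n \<union> {q 0} = g ` ?I"
    by (auto simp: bottom_row_def g_def image_iff atMost_Suc)
  have form: "top_form n f (f (Suc (2^n))) = (1/2) * (\<Sum>i\<in>?I. \<Sum>j\<in>?I. C i j * (f i - f j)^2)" for f
  proof -
    have m0: "sum m ?I = 0"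
      unfolding sum_I by (simp add: m_def sum_negf sum_trap_weight)
    have mf: "(\<Sum>i\<in>?I. m i * f i) = f (Suc (2^n)) - trap_mean n f"
      unfolding sum_I by (simp add: m_def sum_negf trap_mean_def)
    have "(1/2) * (\<Sum>i\<in>?I. \<Sum>j\<in>?I. C i j * (f i - f j)^2)
      = (1/2) * (\<Sum>i\<in>?I. \<Sum>j\<in>?I. (if i \<le> 2^n \<and> j \<le> 2^n then row_cond n i j else 0) * (f i - f j)^2)
        + top_cond n * ((1/2) * (\<Sum>i\<in>?I. \<Sum>j\<in>?I. - (m i * m j) * (f i - f j)^2))"
      unfolding sum_distrib_left sum.distrib[symmetric] C_def
      by (intro sum.cong refl) (simp add: algebra_simps)
    also have "(\<Sum>i\<in>?I. \<Sum>j\<in>?I. (if i \<le> 2^n \<and> j \<le> 2^n then row_cond n i j else 0) * (f i - f j)^2)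
      = (\<Sum>i\<le>2^n. \<Sum>j\<le>2^n. row_cond n i j * (f i - f j)^2)"
      unfolding sum_I by simp
    finally show ?thesis
      unfolding square_zero_sum[OF m0, symmetric] mf row_form_eq[symmetric] top_form_def ..
  qed
  have "conductance q (g ` ?I) (g i) (g j) = C i j"
  proof (rule conductance_eqI)
    show "inj_on g ?I"
      using top_notin_row top_notin_row[symmetric] inj_row_pt by (auto simp: inj_on_def g_def atMost_Suc dest: injD)
    show "C i j = C j i" for i j by (simp add: C_def row_cond_sym mult.commute)
    fix f :: "nat \<Rightarrow> real"
    obtain u where "u \<in> dom_energy q" "u (q 0) = f (Suc (2^n))" "\<And>i. i \<le> 2^n \<Longrightarrow> u (row_pt q n i) = f i"
      "energy q u = ereal (top_form n f (f (Suc (2^n))))"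
      using top_form_minimizer by blast
    then show "\<exists>u. u \<in> dom_energy q \<and> (\<forall>i\<in>?I. u (g i) = f i) \<and>
        energy q u = ereal ((1/2) * (\<Sum>i\<in>?I. \<Sum>j\<in>?I. C i j * (f i - f j)^2))"
      unfolding form by (auto simp: g_def atMost_Suc intro!: exI[of _ u])
  next
    fix v
    \<comment> \<open>The form reads only indices up to \<open>2^n\<close>, where \<open>g\<close>
      is \<open>row_pt q n\<close>.\<close>
    have "top_form n (\<lambda>i. v (g i)) t = top_form n (\<lambda>i. v (row_pt q n i)) t" for t
      by (simp add: top_form_def trap_mean_def row_form_eq g_def)
    then show "ereal ((1/2) * (\<Sum>i\<in>?I. \<Sum>j\<in>?I. C i j * (v (g i) - v (g j))^2)) \<le> energy q v"
      using energy_ge_top_form[of n v] unfolding form[of "\<lambda>i. v (g i)", symmetric] by (simp add: g_def)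
  qed (use assms in auto)
  then show ?thesis unfolding set C_def .
qed

lemma a_cond_eq: "a_cond q n = top_cond n / 2^(n+1)"
proof -
  have "a_cond q n = top_cond n * trap_weight n 0"
    using conductance_with_top[of "2^n + 1" n 0] by (simp add: a_cond_def)
  then show ?thesis by (simp add: trap_weight_def)
qed

lemma b_cond_eq: "b_cond q n = row_cond n 0 (2^n) - top_cond n / 4^(n+1)"
proof -
  have "b_cond q n = row_cond n 0 (2^n) - top_cond n * (trap_weight n 0 * trap_weight n (2^n))"
    using conductance_with_top[of 0 n "2^n"] by (simp add: b_cond_def)
  moreover have "(4::real)^n = 2^n * 2^n" by (simp flip: power_mult_distrib)
  ultimately show ?thesis by (simp add: trap_weight_def)
qed

end

theorem corollary2p2:
  fixes q :: "nat \<Rightarrow> real^2" and n :: nat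
  assumes "equilateral q" and "n \<ge> 1"
  shows "(\<forall>j. 2^(n-1) < j \<and> j < 2^n \<longrightarrow> c_tilde q n 0 j = 2 * b_tilde q n) \<and>
    (\<forall>j. 0 < j \<and> j < 2^(n-1) \<longrightarrow> c_tilde q n j (2^n) = 2 * b_tilde q n) \<and>
    (\<forall>i j. 0 < i \<and> i < 2^(n-1) \<and> 2^(n-1) < j \<and> j < 2^n \<longrightarrow>
        c_tilde q n i j = 4 * b_tilde q n) \<and>
    b_tilde q n = a_cond q n / 2^(n+1) + b_cond q n \<and>
    b_tilde q n = 35 * 5^n / (10 * 6^n + 32 * 20^n)"
proof -
  obtain k where n: "n = Suc k" using assms(2) by (cases n) auto
  define B :: real where "B = 35 * 5^n / (10 * 6^n + 32 * 20^n)"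
  \<comment> \<open>One formula covers every pair separated by the midpoint; the cases below differ
    only in how many of the two points are endpoints of the row.\<close>
  have cross: "c_tilde q n i j = B * (if i = 0 then 1 else 2) * (if j = 2^n then 1 else 2)"
    if "i < 2^(n-1)" "2^(n-1) < j" "j \<le> 2^n" for i j
    using c_tilde_eq[OF assms(1), of i n j] row_cond_cross[of i k j] that unfolding n B_def by simp
  have "(0::nat) < 2^(n-1)" "2^(n-1) < (2::nat)^n" by (simp_all add: n)
  note B = cross[OF this order_refl, folded b_tilde_def, simplified]
  have "b_tilde q n = row_cond n 0 (2^n)"
    using c_tilde_eq[OF assms(1), of 0 n "2^n"] by (simp add: b_tilde_def)
  \<comment> \<open>This is exactly the amount \<open>top_cond n / 4^(n+1)\<close> by which
    \<open>b_cond\<close> falls short of the row conductance.\<close>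
  moreover have "a_cond q n / 2^(n+1) = top_cond n / 4^(n+1)"
    unfolding a_cond_eq[OF assms(1)] by (simp flip: power_mult_distrib)
  ultimately have "b_tilde q n = a_cond q n / 2^(n+1) + b_cond q n"
    unfolding b_cond_eq[OF assms(1)] by simp
  moreover have "c_tilde q n 0 j = 2 * b_tilde q n" if "2^(n-1) < j" "j < 2^n" for j
    using that by (simp add: B cross)
  moreover have "c_tilde q n j (2^n) = 2 * b_tilde q n" if "0 < j" "j < 2^(n-1)" for j
    using that \<open>2^(n-1) < 2^n\<close> by (simp add: B cross)
  moreover have "c_tilde q n i j = 4 * b_tilde q n"
    if "0 < i" "i < 2^(n-1)" "2^(n-1) < j" "j < 2^n" for i j
    using that by (simp add: B cross)
  ultimately show ?thesis using B unfolding B_def by blast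
qed

end
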